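(* Let $p$ be a prime, let $F_p(n)$ denote the number of binomial coefficients $\binom{m}{k}$ with $0\le k\le m<n$ that are not divisible by $p$, let $\varrho_p=\log_p\binom{p+1}{2}$, and let $\beta_p:=\inf_{n\ge1}F_p(n)/n^{\varrho_p}$. For integers $\xi,\eta$ put $$B_{\xi,\eta}:=\binom{\xi+1}{2}\left(1+\frac{(p-2\eta)(p-2\eta+1)}{2\xi p(p+1)}\right)\left(\frac{2\xi+1}{2}-\frac{\eta}{p}\right)^{-\varrho_p}.$$ Then $$\beta_5=\left(\tfrac32\right)^{1-\varrho_5},\qquad \beta_7=\left(\tfrac32\right)^{1-\varrho_7},\qquad \beta_{11}=\tfrac{59}{44}\left(\tfrac{22}{31}\right)^{\varrho_{11}}.$$ More generally, for every odd prime $p$ with $3\le p\le 113$ we have $\beta_p=B_{\xi,\eta}$, where $(\xi,\eta)$ is given by: $(\xi,\eta)=(1,0)$ for $p\in\{3,5,7\}$; $(\xi,\eta)=(1,1)$ for $p\in\{11,13,17,19,23\}$; $(\xi,\eta)=(2,1)$ for $p=29$; $(\xi,\eta)=(2,2)$ for $p\in\{31,37,41,43,47,53\}$; $(\xi,\eta)=(2,3)$ for $p\in\{59,61,67,71,73,79\}$; $(\xi,\eta)=(2,4)$ for $p\in\{83,89,97,101,103,107\}$; $(\xi,\eta)=(2,5)$ for $p\in\{109,113\}$.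
   Context: It is known that $\inf_{n\ge1}F_p(n)/n^{\varrho_p}=\liminf_{n\to\infty}F_p(n)/n^{\varrho_p}$. The value $B_{\xi,\eta}$ equals $G(\hat s)$ at the point $\hat s=\frac{2\xi+1}{2p}-\frac{\eta}{p^2}$, where $G$ is the function with $F_p(n)n^{-\varrho_p}=G(np^{-\lfloor\log_p n\rfloor-1})$ (this interpretation is not needed for the claim). *)

theory Defs
  imports Complex_Main "HOL-Computational_Algebra.Primes"
begin

definition F :: "nat \<Rightarrow> nat \<Rightarrow> nat" where
  "F p n = card {(m, k). k \<le> m \<and> m < n \<and> \<not> p dvd (m choose k)}"

definition \<rho> :: "nat \<Rightarrow> real" where
  "\<rho> p = log (real p) (real ((p + 1) choose 2))"

definition \<beta> :: "nat \<Rightarrow> real" where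
  "\<beta> p = (INF n\<in>{1..}. real (F p n) / real n powr \<rho> p)"

(* The generalised binomial is used since \<xi> ranges over all integers. *)
definition B :: "nat \<Rightarrow> int \<Rightarrow> int \<Rightarrow> real" where
  "B p \<xi> \<eta> =
     ((of_int \<xi> + 1) gchoose 2) *
     (1 + (real p - 2 * of_int \<eta>) * (real p - 2 * of_int \<eta> + 1) /
          (2 * of_int \<xi> * real p * (real p + 1))) *
     ((2 * of_int \<xi> + 1) / 2 - of_int \<eta> / real p) powr (- \<rho> p)"

(* The listed values are exactly the odd primes up to 113. *)
definition \<xi>\<eta> :: "nat \<Rightarrow> int \<times> int" where
  "\<xi>\<eta> p =
     (if p \<in> {3, 5, 7} then (1, 0)
      else if p \<in> {11, 13, 17, 19, 23} then (1, 1)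
      else if p = 29 then (2, 1)
      else if p \<in> {31, 37, 41, 43, 47, 53} then (2, 2)
      else if p \<in> {59, 61, 67, 71, 73, 79} then (2, 3)
      else if p \<in> {83, 89, 97, 101, 103, 107} then (2, 4)
      else if p \<in> {109, 113} then (2, 5)
      else undefined)"

end

theory Submission
  imports Defs "HOL-Number_Theory.Cong"
begin

text \<open>
  By Lucas' theorem, \<open>F p (a * p ^ k + m) = a (a + 1) / 2 * q ^ k + (a + 1) * F p m\<close> for a digit
  \<open>a\<close> and \<open>m \<le> p ^ k\<close>, where \<open>q = p (p + 1) / 2\<close> and \<open>p powr \<rho> p = q\<close>. Hence the points
  \<open>(n / p ^ k, F p n / q ^ k)\<close> form a graph that is self-similar under prepending a digit. The digit
  \<open>(p - 1) / 2\<close> fixes the point \<open>(1/2, 1/4)\<close> and preserves slopes there, so this graph lies above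
  two lines through \<open>(1/2, 1/4)\<close> with slopes slightly below and slightly above 1.

  The value \<open>B p \<xi> \<eta>\<close> is the limit of \<open>F p n / n powr \<rho> p\<close> along the digit sequences
  \<open>\<xi>, (p - 1) / 2 - \<eta>, (p - 1) / 2, (p - 1) / 2, ...\<close>, which gives the upper bound. For the lower
  bound, weighted AM-GM bounds the power function \<open>y powr \<rho> p\<close> by a convex parabola touching it at a
  chosen point. Compared with the piecewise linear lower bound for \<open>F\<close> after fixing one or two
  leading digits, convexity leaves only three breakpoints, and at each of them the comparison is the
  nonnegativity of a quadratic polynomial in the last fixed digit. Taking rational bounds for
  \<open>\<rho> p\<close>, these are finitely many statements about integers.
\<close>

section \<open>Lucas' theorem and the recursion for \<open>F\<close>\<close>

text \<open>In Vandermonde's sum for \<open>p + n\<close>, the coefficients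
  \<open>p choose i\<close> with \<open>0 < i < p\<close> vanish modulo \<open>p\<close>. Only
  \<open>i = 0\<close> and \<open>i = p\<close> survive, the latter if
  \<open>p \<le> k\<close>.\<close>

lemma choose_add_prime_cong:
  fixes p n k :: nat
  assumes "prime p"
  shows "[(p + n) choose k = (n choose k) + (if p \<le> k then n choose (k - p) else 0)] (mod p)"
proof -
  let ?g = "\<lambda>i. (p choose i) * (n choose (k - i))"
  let ?h = "\<lambda>i. (if i = 0 then n choose k else 0) + (if i = p then n choose (k - p) else 0)"
  have p: "p > 0"
    using assms by (simp add: prime_gt_0_nat)
  have "[?g i = ?h i] (mod p)" for i
  proof (cases "0 < i \<and> i < p")
    case True
    then have "p dvd (p choose i)"
      using assms by (intro dvd_choose_prime) auto
    with True show ?thesis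
      by (simp add: cong_0_iff)
  next
    case False
    then have "i = 0 \<or> i = p \<or> p < i"
      by auto
    then show ?thesis
      using p by (auto simp: cong_def binomial_eq_0)
  qed
  then have "[(\<Sum>i\<le>k. ?g i) = (\<Sum>i\<le>k. ?h i)] (mod p)"
    by (intro cong_sum) auto
  moreover have "(\<Sum>i\<le>k. ?h i) = (n choose k) + (if p \<le> k then n choose (k - p) else 0)"
    by (simp add: sum.distrib)
  ultimately show ?thesis
    by (simp add: vandermonde)
qed

text \<open>Lucas' theorem for splitting off the last digit. Raising \<open>m\<close> by one adds
  \<open>p\<close> to the upper index, so the previous congruence reduces the induction step to
  Pascal's rule for \<open>Suc m choose k\<close>.\<close>

lemma lucas_cong:
  fixes p m k r s :: nat
  assumes "prime p" "r < p" "s < p"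
  shows "[(p * m + r) choose (p * k + s) = (m choose k) * (r choose s)] (mod p)"
proof (induction m arbitrary: k)
  case 0
  show ?case
  proof (cases k)
    case (Suc j)
    then have "r < p * k + s"
      using assms by simp
    with Suc show ?thesis
      by (simp add: binomial_eq_0)
  qed simp
next
  case (Suc m)
  let ?rhs = "((p * m + r) choose (p * k + s)) +
    (if p \<le> p * k + s then (p * m + r) choose (p * k + s - p) else 0)"
  have "[(p * Suc m + r) choose (p * k + s) = ?rhs] (mod p)"
    using choose_add_prime_cong[OF assms(1), of "p * m + r" "p * k + s"]
    by (simp add: algebra_simps)
  also have "[?rhs = (Suc m choose k) * (r choose s)] (mod p)"
  proof (cases k)
    case 0
    then show ?thesis
      using Suc.IH[of 0] assms by simp
  next
    case (Suc j)
    have "[((p * m + r) choose (p * k + s)) + ((p * m + r) choose (p * j + s)) =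
        (m choose k) * (r choose s) + (m choose j) * (r choose s)] (mod p)"
      by (intro cong_add Suc.IH)
    with Suc show ?thesis
      by (simp add: algebra_simps)
  qed
  finally show ?case .
qed

section \<open>Rows of Pascal's triangle modulo \<open>p\<close>\<close>

definition row_count :: "nat \<Rightarrow> nat \<Rightarrow> nat" where
  "row_count p m = card {k. k \<le> m \<and> \<not> p dvd (m choose k)}"

lemma F_eq_sum_row_count: "F p n = (\<Sum>m<n. row_count p m)"
proof -
  have "{(m, k). k \<le> m \<and> m < n \<and> \<not> p dvd (m choose k)} =
      Sigma {..<n} (\<lambda>m. {k. k \<le> m \<and> \<not> p dvd (m choose k)})"
    by auto
  then show ?thesis
    by (simp add: F_def row_count_def)
qed

text \<open>For \<open>s \<le> r\<close> the number \<open>r choose s\<close> divides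
  \<open>fact r\<close>, which is prime to \<open>p\<close> because \<open>r < p\<close>. With
  \<open>lucas_cong\<close>, the surviving columns correspond to pairs of a surviving column of row
  \<open>m\<close> and a last digit \<open>s \<le> r\<close>.\<close>

lemma row_count_digit:
  assumes "prime p" "r < p"
  shows "row_count p (p * m + r) = Suc r * row_count p m"
proof -
  have p: "p > 0"
    using assms by simp
  have dvd: "p dvd ((p * m + r) choose (p * k + s)) \<longleftrightarrow> p dvd (m choose k) \<or> r < s"
    if "s < p" for k s
  proof -
    have "p dvd ((p * m + r) choose (p * k + s)) \<longleftrightarrow> p dvd (m choose k) * (r choose s)"
      using lucas_cong[OF assms that] cong_dvd_iff by blast
    moreover have "p dvd (r choose s) \<longleftrightarrow> r < s"
    proof
      assume "p dvd (r choose s)"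
      show "r < s"
      proof (rule ccontr)
        assume "\<not> r < s"
        then have "(r choose s) dvd fact r"
          by (metis binomial_fact_lemma dvd_triv_right not_less)
        with \<open>p dvd (r choose s)\<close> have "p dvd fact r"
          by (rule dvd_trans)
        with assms show False
          by (simp add: prime_dvd_fact_iff)
      qed
    qed (simp add: binomial_eq_0)
    ultimately show ?thesis
      using assms by (simp add: prime_dvd_mult_iff)
  qed
  have "bij_betw (\<lambda>(k, s). p * k + s) ({k. k \<le> m \<and> \<not> p dvd (m choose k)} \<times> {..r})
      {k. k \<le> p * m + r \<and> \<not> p dvd ((p * m + r) choose k)}"
  proof (rule bij_betw_byWitness[where f' = "\<lambda>k. (k div p, k mod p)"])
    show "\<forall>x\<in>{k. k \<le> m \<and> \<not> p dvd (m choose k)} \<times> {..r}.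
        (\<lambda>k. (k div p, k mod p)) ((\<lambda>(k, s). p * k + s) x) = x"
      using assms by auto
    show "(\<lambda>(k, s). p * k + s) ` ({k. k \<le> m \<and> \<not> p dvd (m choose k)} \<times> {..r}) \<subseteq>
        {k. k \<le> p * m + r \<and> \<not> p dvd ((p * m + r) choose k)}"
      using assms by (auto simp: dvd intro!: add_mono)
    have "k div p \<le> m \<and> \<not> p dvd (m choose (k div p)) \<and> k mod p \<le> r"
      if "\<not> p dvd ((p * m + r) choose k)" for k
    proof -
      have "\<not> (p dvd (m choose (k div p)) \<or> r < k mod p)"
        using dvd[of "k mod p" "k div p"] that p by simp
      moreover from this have "k div p \<le> m"
        by (metis binomial_eq_0 dvd_0_right not_less)
      ultimately show ?thesis
        by simp
    qed
    then show "(\<lambda>k. (k div p, k mod p)) ` {k. k \<le> p * m + r \<and> \<not> p dvd ((p * m + r) choose k)} \<subseteq>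
        {k. k \<le> m \<and> \<not> p dvd (m choose k)} \<times> {..r}"
      by auto
  qed simp
  then have "row_count p (p * m + r) = card ({k. k \<le> m \<and> \<not> p dvd (m choose k)} \<times> {..r})"
    unfolding row_count_def by (rule bij_betw_same_card[symmetric])
  then show ?thesis
    by (simp add: row_count_def card_cartesian_product)
qed

text \<open>Lucas' congruence strips last digits, while the recursion for \<open>F\<close> needs the
  leading one. Since each digit contributes an independent factor, induction on \<open>k\<close>
  sets last digits aside until only \<open>a\<close> is left.\<close>

lemma row_count_leading_digit:
  assumes "prime p" "a < p" "m < p ^ k"
  shows "row_count p (a * p ^ k + m) = Suc a * row_count p m"
  using assms(3)
proof (induction k arbitrary: m)
  case 0
  then show ?case
    using row_count_digit[OF assms(1,2), of 0] by simp
next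
  case (Suc k)
  have p: "p > 0"
    using assms by simp
  have less: "m div p < p ^ k"
    using Suc.prems by (simp add: less_mult_imp_div_less mult.commute)
  have "a * p ^ Suc k + m = p * (a * p ^ k + m div p) + m mod p"
    by (simp add: algebra_simps)
  then have "row_count p (a * p ^ Suc k + m) = Suc (m mod p) * row_count p (a * p ^ k + m div p)"
    using row_count_digit[OF assms(1), of "m mod p" "a * p ^ k + m div p"] p by simp
  also have "\<dots> = Suc a * (Suc (m mod p) * row_count p (m div p))"
    using Suc.IH[OF less] by (simp add: algebra_simps)
  also have "Suc (m mod p) * row_count p (m div p) = row_count p m"
    using row_count_digit[OF assms(1), of "m mod p" "m div p"] p by simp
  finally show ?case .
qed

text \<open>The boundary case \<open>m = p ^ k\<close> is included so that complete blocks can be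
  added up in \<open>F_multiple_power\<close>.\<close>

lemma F_leading_digit_aux:
  assumes "prime p" "a < p" "m \<le> p ^ k"
  shows "F p (a * p ^ k + m) = F p (a * p ^ k) + Suc a * F p m"
proof -
  have "F p (a * p ^ k + m) = F p (a * p ^ k) + (\<Sum>i<m. row_count p (a * p ^ k + i))"
    by (induction m) (simp_all add: F_eq_sum_row_count)
  also have "(\<Sum>i<m. row_count p (a * p ^ k + i)) = (\<Sum>i<m. Suc a * row_count p i)"
    using assms by (intro sum.cong) (auto simp: row_count_leading_digit)
  finally show ?thesis
    by (simp add: F_eq_sum_row_count sum_distrib_left)
qed

text \<open>The blocks contribute 1, 2, ..., \<open>a\<close> copies of the first one. Allowing
  \<open>a = p\<close> also yields the step from \<open>p ^ k\<close> to
  \<open>p ^ Suc k\<close>.\<close>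

lemma F_multiple_power:
  assumes "prime p" "a \<le> p"
  shows "real (F p (a * p ^ k)) = real a * (real a + 1) / 2 * real (F p (p ^ k))"
  using assms(2)
proof (induction a)
  case 0
  then show ?case
    by (simp add: F_eq_sum_row_count)
next
  case (Suc a)
  have "F p (Suc a * p ^ k) = F p (a * p ^ k) + Suc a * F p (p ^ k)"
    using F_leading_digit_aux[OF assms(1), of a "p ^ k" k] Suc.prems by (simp add: add.commute)
  then show ?case
    using Suc by (simp add: field_simps)
qed

lemma F_prime_power:
  assumes "prime p"
  shows "F p (p ^ k) = ((p + 1) choose 2) ^ k"
proof (induction k)
  case 0
  have "{k::nat. k = 0 \<and> \<not> p dvd (0 choose k)} = {0}"
    using assms by auto
  then show ?case
    by (simp add: F_eq_sum_row_count row_count_def)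
next
  case (Suc k)
  have "real (F p (p ^ Suc k)) = real p * (real p + 1) / 2 * real (F p (p ^ k))"
    using F_multiple_power[OF assms order_refl] by simp
  also have "real p * (real p + 1) / 2 = real ((p + 1) choose 2)"
    by (simp add: choose_two real_of_nat_div algebra_simps)
  finally show ?case
    using Suc by (metis of_nat_eq_iff of_nat_mult power_Suc)
qed

lemma F_leading_digit:
  assumes "prime p" "a < p" "m \<le> p ^ k"
  shows "real (F p (a * p ^ k + m)) =
    real a * (real a + 1) / 2 * real ((p + 1) choose 2) ^ k + (real a + 1) * real (F p m)"
  using F_leading_digit_aux[OF assms] F_multiple_power[of p a k] F_prime_power[of p k] assms
  by (simp add: algebra_simps)

section \<open>Supporting lines of the normalised counting function\<close>

definition lower_slope :: "real \<Rightarrow> real" where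
  "lower_slope p = 1 - (3 / 2 - 1 / (p + 1)) / (p + 1)"

definition upper_slope :: "real \<Rightarrow> real" where
  "upper_slope p = 1 + 1 / (2 * (p + 1))"

definition above_lines :: "real \<Rightarrow> real \<Rightarrow> real \<Rightarrow> bool" where
  "above_lines p x v \<longleftrightarrow>
     0 \<le> v \<and> v \<ge> 1 / 4 + lower_slope p * (x - 1 / 2) \<and> v \<ge> 1 / 4 + upper_slope p * (x - 1 / 2)"

text \<open>Measuring by the excess \<open>e\<close> over the line of slope 1 through
  \<open>(1/2, 1/4)\<close> leaves only the deviations of the two slopes from 1, and the factor
  \<open>P\<close> makes these of order 1.\<close>

lemma above_lines_iff_excess:
  assumes "p \<ge> 3" "P = p + 1" "e = v - x + 1 / 4"
  shows "above_lines p x v \<longleftrightarrow>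
    0 \<le> v \<and> P * e \<ge> (3 / 2 - 1 / P) * (1 / 2 - x) \<and> P * e \<ge> (x - 1 / 2) / 2"
proof -
  have P: "P > 0"
    using assms by simp
  have slopes: "lower_slope p = 1 - (3 / 2 - 1 / P) / P" "upper_slope p = 1 + 1 / (2 * P)"
    by (simp_all add: lower_slope_def upper_slope_def assms(2))
  have 1: "P * (1 / 4 + lower_slope p * (x - 1 / 2)) = P * (x - 1 / 4) + (3 / 2 - 1 / P) * (1 / 2 - x)"
    unfolding slopes using P by (simp add: field_simps)
  have 2: "P * (1 / 4 + upper_slope p * (x - 1 / 2)) = P * (x - 1 / 4) + (x - 1 / 2) / 2"
    unfolding slopes using P by (simp add: field_simps)
  have 3: "P * v = P * (x - 1 / 4) + P * e"
    by (simp add: assms(3) algebra_simps)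
  have "v \<ge> c \<longleftrightarrow> P * v \<ge> P * c" for c
    using P by simp
  then show ?thesis
    unfolding above_lines_def using 1 2 3 by (metis add_le_cancel_left)
qed

text \<open>The slopes are chosen so that both lines through \<open>(1/2, 1/4)\<close> stay below the graph of the
  normalised counting function under the digit map. The middle digit \<open>(p - 1) / 2\<close> preserves slopes
  at that point, and the two digits next to it determine the admissible range of slopes.\<close>

lemma above_lines_digit:
  fixes p a :: nat and x v :: real
  assumes p: "odd p" "p \<ge> 3" and a: "a < p"
    and x: "0 \<le> x" "x \<le> 1" and lines: "above_lines p x v"
  shows "above_lines p ((a + x) / p) ((a + 1) * (a / 2 + v) / (real p * (real p + 1) / 2))"
proof -
  define P where "P = real p + 1"
  define i where "i = 1 / P"
  define e where "e = v - x + 1 / 4"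
  define y where "y = (a + x) / p"
  define v' where "v' = (a + 1) * (a / 2 + v) / (real p * (real p + 1) / 2)"
  define e' where "e' = v' - y + 1 / 4"
  \<comment> \<open>\<open>t\<close> is twice the offset of the digit from
    \<open>(p - 1) / 2\<close>, hence an even integer.\<close>
  define t where "t = 2 * real a + 2 - P"
  define g where "g = P * e"
  have p3: "real p \<ge> 3"
    using p by simp
  have P: "P \<ge> 4"
    using p by (simp add: P_def)
  have v: "v \<ge> 0" and g1: "g \<ge> (3 / 2 - i) * (1 / 2 - x)" and g2: "g \<ge> (x - 1 / 2) / 2"
    using lines above_lines_iff_excess[OF p3 P_def e_def] by (auto simp: g_def i_def)
  have Pinv: "0 < i" "i \<le> 1 / 4"
    using P by (auto simp: i_def field_simps)
  have "g \<ge> 0"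
  proof (cases "x \<le> 1 / 2")
    case True
    then have "0 \<le> (3 / 2 - i) * (1 / 2 - x)"
      using Pinv by (intro mult_nonneg_nonneg) argo+
    with g1 show ?thesis
      by argo
  qed (use g2 in simp)
  then have e: "e \<ge> 0"
    using P by (simp add: g_def zero_le_mult_iff)
  \<comment> \<open>\<open>E\<close> is the new excess \<open>e'\<close> with denominators cleared.
    Since \<open>t - 1 + 2 * x\<close> equals \<open>2 * p * (y - 1 / 2)\<close>, both goals compare
    \<open>E\<close> with a multiple of it.\<close>
  define E where "E = t * (t - 3 + 4 * x) + 4 * (P + t) * e"
  have E: "E = 4 * p * P * e'"
  proof -
    have "4 * p * P * v' = 8 * ((a + 1) * (a / 2 + v))"
      using p P unfolding v'_def P_def by simp
    moreover have "p * y = a + x"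
      using p by (simp add: y_def)
    moreover have "4 * p * P * e' = 4 * p * P * v' - 4 * P * (p * y) + p * P"
      by (simp add: e'_def algebra_simps)
    ultimately have "4 * p * P * e' = 8 * ((a + 1) * (a / 2 + v)) - 4 * P * (a + x) + p * P"
      by simp
    also have "\<dots> = E"
      unfolding E_def t_def e_def P_def by (simp add: algebra_simps diff_divide_distrib)
    finally show ?thesis
      by simp
  qed
  have y: "y - 1 / 2 = (t - 1 + 2 * x) / (2 * p)"
    using p unfolding y_def t_def P_def by (simp add: field_simps)
  have Pt: "P + t \<ge> 0"
    by (simp add: t_def)
  have main: "E \<ge> t - 1 + 2 * x \<and> E \<ge> - (3 - 2 * i) * (t - 1 + 2 * x)"
  proof -
    obtain j where "p = 2 * j + 1"
      using p by (elim oddE)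
    then have t_even: "t = 2 * of_int (int a - int j)"
      by (simp add: t_def P_def)
    consider "int a - int j = 0" | "int a - int j = 1" | "int a - int j = -1"
      | "int a - int j \<ge> 2" | "int a - int j \<le> -2"
      by linarith
    then consider "t = 0" | "t = 2" | "t = -2" | "t \<ge> 4" | "t \<le> -4"
      unfolding t_even by cases auto
    then show ?thesis
    proof cases
      \<comment> \<open>For the middle digit both goals are the two hypotheses on \<open>g\<close>,
        unchanged.\<close>
      case 1
      then have "E = 4 * g"
        by (simp add: E_def g_def)
      moreover have "- (3 - 2 * i) * (t - 1 + 2 * x) = 4 * ((3 / 2 - i) * (1 / 2 - x))"
        using 1 by (simp add: algebra_simps diff_divide_distrib)
      ultimately show ?thesis
        using g1 g2 1 by auto
    next
      \<comment> \<open>The first goal is critical, with equality at \<open>x = 1 / 2\<close> and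
        \<open>g = 0\<close>. For smaller \<open>x\<close> the bound on \<open>4 * g\<close> falls
        short by \<open>4 * i * (1 / 2 - x)\<close>, which \<open>8 * e\<close> makes up
        for.\<close>
      case 2
      have E2: "E = 2 * (4 * x - 1) + 4 * g + 8 * e"
        using 2 by (simp add: E_def g_def algebra_simps)
      have "6 * x - 3 + 4 * g + 8 * e \<ge> 0"
      proof (cases "x \<le> 1 / 2")
        case True
        have "(1 / 2) * (1 / 2 - x) \<le> (3 / 2 - i) * (1 / 2 - x)"
          using True Pinv by (intro mult_right_mono) argo+
        then have "(1 / 2 - x) / 2 \<le> P * e"
          using g1 by (simp add: g_def)
        then have "8 * e \<ge> 4 * i * (1 / 2 - x)"
          using P by (simp add: i_def field_simps)
        moreover have "4 * g \<ge> 6 * (1 / 2 - x) - 4 * i * (1 / 2 - x)"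
          using g1 by (simp add: algebra_simps diff_divide_distrib)
        ultimately show ?thesis
          by (simp add: algebra_simps diff_divide_distrib)
      qed (use \<open>g \<ge> 0\<close> e in argo)
      then have "E \<ge> 1 + 2 * x"
        using E2 by argo
      moreover have "(3 - 2 * i) * (1 + 2 * x) \<ge> 0"
        using Pinv x by (intro mult_nonneg_nonneg) auto
      ultimately show ?thesis
        using 2 x by (simp add: algebra_simps)
    next
      \<comment> \<open>The second goal is critical, with margin \<open>8 * i * (1 - x)\<close>
        vanishing at \<open>x = 1\<close>. Without the correction \<open>1 / (p + 1)\<close> in
        \<open>lower_slope\<close> this estimate would fall short for
        \<open>x > 1 / 2\<close>.\<close>
      case 3
      have E3: "E = 10 - 8 * x + 4 * g * (1 - 2 * i)"
        using 3 P by (simp add: E_def g_def i_def field_simps)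
      have "4 * g * (1 - 2 * i) \<ge> 4 * ((x - 1 / 2) / 2) * (1 - 2 * i)"
        using g2 Pinv by (intro mult_right_mono mult_left_mono) auto
      then have "E \<ge> 9 - 6 * x - 2 * i * (2 * x - 1)"
        unfolding E3 by (simp add: algebra_simps diff_divide_distrib)
      moreover have "2 * i * (2 * x - 1) \<le> 2 * i * (3 - 2 * x)"
        using Pinv x by (intro mult_left_mono) auto
      ultimately have "E \<ge> (3 - 2 * i) * (3 - 2 * x)"
        by (simp add: algebra_simps diff_divide_distrib)
      moreover have "(3 - 2 * i) * (3 - 2 * x) \<ge> 0"
        using Pinv x by (intro mult_nonneg_nonneg) auto
      ultimately show ?thesis
        using 3 x by (simp add: algebra_simps diff_divide_distrib)
    next
      case 4
      \<comment> \<open>Two or more places away from the middle, the quadratic term of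
        \<open>E\<close> suffices together with \<open>e \<ge> 0\<close>.\<close>
      note t4 = 4
      have "E \<ge> t * (t - 3 + 4 * x)"
        unfolding E_def using Pt e by simp
      moreover have "t * (t - 3 + 4 * x) \<ge> 4 * (t - 3 + 4 * x)"
        using t4 x by (intro mult_right_mono) auto
      ultimately have "E \<ge> t - 1 + 2 * x"
        using t4 x by argo
      moreover have "(3 - 2 * i) * (t - 1 + 2 * x) \<ge> 0"
        using Pinv x t4 by (intro mult_nonneg_nonneg) auto
      ultimately show ?thesis
        using t4 x by (simp add: algebra_simps diff_divide_distrib)
    next
      case 5
      define s where "s = - t"
      have s: "s \<ge> 4"
        using 5 by (simp add: s_def)
      have "E \<ge> t * (t - 3 + 4 * x)"
        unfolding E_def using Pt e by simp
      also have "t * (t - 3 + 4 * x) = s * (s + 3 - 4 * x)"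
        by (simp add: s_def algebra_simps)
      finally have "E \<ge> s * (s + 3 - 4 * x)" .
      moreover have "s * (s + 3 - 4 * x) \<ge> 4 * (s + 3 - 4 * x)"
        using s x by (intro mult_right_mono) auto
      moreover have "(3 - 2 * i) * (s + 1 - 2 * x) \<le> 3 * (s + 1 - 2 * x)"
        using Pinv s x by (intro mult_right_mono) auto
      ultimately have "E \<ge> (3 - 2 * i) * (s + 1 - 2 * x)"
        using s x by argo
      moreover have "(3 - 2 * i) * (s + 1 - 2 * x) \<ge> 0"
        using Pinv s x by (intro mult_nonneg_nonneg) auto
      ultimately show ?thesis
        using s x by (simp add: s_def algebra_simps)
    qed
  qed
  have E': "P * e' = E / (4 * p)"
    using E p by simp
  have "P * e' \<ge> (y - 1 / 2) / 2"
  proof -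
    have "(y - 1 / 2) / 2 = (t - 1 + 2 * x) / (4 * p)"
      by (simp add: y)
    also have "\<dots> \<le> E / (4 * p)"
      using main by (intro divide_right_mono) auto
    finally show ?thesis
      by (simp add: E')
  qed
  moreover have "P * e' \<ge> (3 / 2 - i) * (1 / 2 - y)"
  proof -
    have "(3 / 2 - i) * (1 / 2 - y) = - ((3 / 2 - i) * (y - 1 / 2))"
      by (simp add: algebra_simps diff_divide_distrib)
    also have "\<dots> = - (3 - 2 * i) * (t - 1 + 2 * x) / (4 * p)"
      unfolding y i_def using p P by (simp add: field_simps)
    also have "\<dots> \<le> E / (4 * p)"
      using main p by (intro divide_right_mono) auto
    finally show ?thesis
      by (simp add: E')
  qed
  moreover have "v' \<ge> 0"
    using v by (simp add: v'_def)
  ultimately show ?thesis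
    using above_lines_iff_excess[OF p3 P_def e'_def] by (simp add: y_def v'_def i_def)
qed

section \<open>The self-similar graph and its two lines\<close>

definition normalised_graph :: "nat \<Rightarrow> (real \<times> real) set" where
  "normalised_graph p =
     {(real n / real p ^ k, real (F p n) / real ((p + 1) choose 2) ^ k) | n k. n < p ^ k}"

lemma real_choose_two_Suc: "real ((p + 1) choose 2) = real p * (real p + 1) / 2"
  by (simp add: choose_two real_of_nat_div algebra_simps)

lemma normalised_graph_zero: "(0, 0) \<in> normalised_graph p"
  unfolding normalised_graph_def by (force simp: F_def intro!: exI[of _ 0])

lemma normalised_graph_range:
  assumes "(x, v) \<in> normalised_graph p"
  shows "0 \<le> x" "x < 1"
proof -
  obtain n k where "x = real n / real p ^ k" "n < p ^ k"
    using assms by (auto simp: normalised_graph_def)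
  moreover from this have "real n < real p ^ k"
    by (metis of_nat_less_iff of_nat_power)
  ultimately show "0 \<le> x" "x < 1"
    by (auto simp: divide_less_eq simp del: of_nat_power_less_of_nat_cancel_iff)
qed

text \<open>Scaling by \<open>p ^ k\<close> instead of \<open>p ^ Suc k\<close> keeps the leading
  digit as integer part, the form in which \<open>F_lower_bound\<close> compares with the power
  function.\<close>

lemma leading_digit_decomposition:
  assumes p: "prime p" and n: "n < p ^ Suc k"
  obtains a m where "a < p" "m < p ^ k" "a = n div p ^ k"
    "real n / real p ^ k = real a + real m / real p ^ k"
    "real (F p n) / real ((p + 1) choose 2) ^ k =
      (real a + 1) * (real a / 2 + real (F p m) / real ((p + 1) choose 2) ^ k)"
proof -
  define q where "q = real ((p + 1) choose 2)"
  define a m where "a = n div p ^ k" and "m = n mod p ^ k"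
  have p0: "p > 0"
    using p by (simp add: prime_gt_0_nat)
  have q: "q > 0"
    using p0 unfolding q_def real_choose_two_Suc by simp
  have n_eq: "n = a * p ^ k + m"
    unfolding a_def m_def by (rule div_mult_mod_eq[symmetric])
  have a: "a < p"
    using n by (simp add: a_def less_mult_imp_div_less)
  have m: "m < p ^ k"
    using p0 by (simp add: m_def)
  show ?thesis
  proof (rule that[OF a m])
    show "a = n div p ^ k"
      by (fact a_def)
    show "real n / real p ^ k = real a + real m / real p ^ k"
      using p0 by (simp add: n_eq field_simps)
    show "real (F p n) / real ((p + 1) choose 2) ^ k =
        (real a + 1) * (real a / 2 + real (F p m) / real ((p + 1) choose 2) ^ k)"
      using F_leading_digit[OF p a less_imp_le[OF m]] q
      unfolding n_eq q_def[symmetric] by (simp add: field_simps)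
  qed
qed

lemma normalised_graph_digit:
  assumes p: "prime p" and "(x, v) \<in> normalised_graph p"
  obtains b :: nat and x' v' :: real where "b < p" "(x', v') \<in> normalised_graph p" "x = (b + x') / p"
    "v = (real b + 1) * (b / 2 + v') / (real p * (real p + 1) / 2)"
proof -
  define q where "q = real ((p + 1) choose 2)"
  have p0: "p > 0"
    using p by (simp add: prime_gt_0_nat)
  have q: "q > 0" "q = real p * (real p + 1) / 2"
    using p0 unfolding q_def real_choose_two_Suc by simp_all
  obtain n k where nk: "x = real n / real p ^ k" "v = real (F p n) / q ^ k" "n < p ^ k"
    using assms(2) by (auto simp: normalised_graph_def q_def)
  show ?thesis
  proof (cases k)
    \<comment> \<open>The point is then the origin, which is its own image under the digit
      0.\<close>
    case 0
    with nk have "x = 0" "v = 0"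
      by (auto simp: F_def)
    with that[OF p0 normalised_graph_zero] show ?thesis
      by simp
  next
    case (Suc j)
    obtain b m where bm: "b < p" "m < p ^ j" "real n / real p ^ j = real b + real m / real p ^ j"
      "real (F p n) / q ^ j = (real b + 1) * (real b / 2 + real (F p m) / q ^ j)"
      using leading_digit_decomposition[OF p, of n j] nk Suc unfolding q_def by metis
    show ?thesis
    proof (rule that[OF bm(1)])
      show "(real m / real p ^ j, real (F p m) / q ^ j) \<in> normalised_graph p"
        unfolding normalised_graph_def q_def using bm(2) by auto
      show "x = (b + real m / real p ^ j) / p"
        by (simp add: nk Suc bm(3)[symmetric])
      show "v = (real b + 1) * (b / 2 + real (F p m) / q ^ j) / (real p * (real p + 1) / 2)"
      proof -
        have "v = real (F p n) / q ^ j / q"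
          by (simp add: nk Suc)
        then show ?thesis
          unfolding bm(4) q(2)[symmetric] by (simp add: add.commute)
      qed
    qed
  qed
qed

lemma normalised_graph_above_lines:
  assumes p: "prime p" "odd p" and "(x, v) \<in> normalised_graph p"
  shows "above_lines p x v"
proof -
  have p3: "p \<ge> 3"
    using p prime_ge_2_nat[of p] by (cases "p = 2") auto
  \<comment> \<open>The origin lies above both lines because both slopes are at least
    \<open>1 / 2\<close>.\<close>
  have "(3 / 2 - 1 / (real p + 1)) / (real p + 1) \<le> (3 / 2) / 3"
    using p3 by (intro frac_le) auto
  then have zero: "above_lines p 0 0"
    by (simp add: above_lines_def lower_slope_def upper_slope_def)
  have "above_lines p (real n / real p ^ k) (real (F p n) / real ((p + 1) choose 2) ^ k)"
    if "n < p ^ k" for n k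
    using that
  proof (induction k arbitrary: n)
    case 0
    then show ?case
      using zero by (simp add: F_def)
  next
    case (Suc k)
    define q where "q = real ((p + 1) choose 2)"
    have q: "q = real p * (real p + 1) / 2"
      unfolding q_def by (rule real_choose_two_Suc)
    obtain a m where am: "a < p" "m < p ^ k" "real n / real p ^ k = real a + real m / real p ^ k"
      "real (F p n) / q ^ k = (real a + 1) * (real a / 2 + real (F p m) / q ^ k)"
      using leading_digit_decomposition[OF p(1) Suc.prems] unfolding q_def by metis
    have "real m < real p ^ k"
      using am(2) by (metis of_nat_less_iff of_nat_power)
    then have "above_lines p ((a + real m / real p ^ k) / p)
        ((a + 1) * (a / 2 + real (F p m) / q ^ k) / (real p * (real p + 1) / 2))"
      using p p3 am(1) Suc.IH[OF am(2)] unfolding q_def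
      by (intro above_lines_digit) (auto simp: field_simps)
    then have "above_lines p (real n / real p ^ k / p) (real (F p n) / q ^ k / q)"
      unfolding am(3,4) q[symmetric] by (simp add: add.commute)
    then show ?case
      by (simp add: q_def mult.commute)
  qed
  then show ?thesis
    using assms(3) by (auto simp: normalised_graph_def)
qed

section \<open>Tangent parabolas of the power function\<close>

text \<open>The parabola through the origin that agrees with \<open>z powr r\<close> to first order
  at \<open>z = 1\<close>.\<close>

definition quad_fun :: "real \<Rightarrow> real \<Rightarrow> real" where
  "quad_fun r z = (2 - r) * z + (r - 1) * z\<^sup>2"

text \<open>Weighted AM-GM for \<open>z\<close> and \<open>z\<^sup>2\<close> with weights
  \<open>2 - r\<close> and \<open>r - 1\<close>, after cancelling one factor
  \<open>z\<close>.\<close>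

lemma powr_le_quad_fun:
  assumes z: "z > 0" and r: "1 \<le> r" "r \<le> 2"
  shows "z powr r \<le> quad_fun r z"
proof -
  define u where "u = (2 - r) + (r - 1) * z"
  have u: "u > 0"
  proof (cases "r = 2")
    case False
    then show ?thesis
      using r z by (auto simp: u_def intro!: add_pos_nonneg mult_nonneg_nonneg)
  qed (use z in \<open>simp add: u_def\<close>)
  \<comment> \<open>The bound \<open>ln s \<le> s - 1\<close> is used at \<open>z / u\<close> and
    \<open>1 / u\<close>. As \<open>u\<close> is the weighted mean of \<open>z\<close> and 1, the
    right-hand side cancels to 0.\<close>
  have "(r - 1) * ln (z / u) + (2 - r) * ln (1 / u) \<le> (r - 1) * (z / u - 1) + (2 - r) * (1 / u - 1)"
    using r z u by (intro add_mono mult_left_mono ln_le_minus_one) auto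
  also have "\<dots> = u / u - 1"
    using u unfolding u_def by (simp add: field_simps)
  also have "\<dots> = 0"
    using u by simp
  finally have "(r - 1) * (ln z - ln u) - (2 - r) * ln u \<le> 0"
    using z u by (simp add: ln_div)
  then have "(r - 1) * ln z \<le> ln u"
    by (simp add: algebra_simps)
  then have "z powr (r - 1) \<le> u"
    using z u by (simp add: powr_def ln_ge_iff[symmetric])
  then have "z * z powr (r - 1) \<le> z * u"
    using z by simp
  then show ?thesis
    using z by (simp add: powr_diff quad_fun_def u_def power2_eq_square algebra_simps)
qed

lemma quad_fun_mono:
  assumes "1 \<le> r" "r \<le> 2" "0 \<le> x" "x \<le> y"
  shows "quad_fun r x \<le> quad_fun r y"
  using assms unfolding quad_fun_def by (intro add_mono mult_left_mono power_mono) auto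

lemma quad_fun_convex:
  assumes "1 \<le> r" "0 \<le> l" "l \<le> 1"
  shows "quad_fun r ((1 - l) * x + l * y) \<le> (1 - l) * quad_fun r x + l * quad_fun r y"
proof -
  have "(1 - l) * quad_fun r x + l * quad_fun r y - quad_fun r ((1 - l) * x + l * y) =
      (r - 1) * (l * (1 - l) * (x - y)\<^sup>2)"
    by (simp add: quad_fun_def power2_eq_square algebra_simps)
  moreover have "0 \<le> (r - 1) * (l * (1 - l) * (x - y)\<^sup>2)"
    using assms by simp
  ultimately show ?thesis
    by simp
qed

text \<open>The convex left-hand side lies below its chord, and since \<open>A1 \<ge> 0\<close> the
  right-hand side dominates an affine function of \<open>x\<close>. Comparing at the two ends is
  therefore enough.\<close>

lemma quad_fun_le_on_segment:
  fixes A0 A1 v0 v1 c :: real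
  assumes r: "1 \<le> r" and c: "0 \<le> c" and A1: "0 \<le> A1"
    and seg: "t0 < t1" "t0 \<le> x" "x \<le> t1"
    and v: "v \<ge> v0 + (v1 - v0) / (t1 - t0) * (x - t0)"
    and 0: "c * quad_fun r (s * (b + t0)) \<le> A0 + A1 * v0"
    and 1: "c * quad_fun r (s * (b + t1)) \<le> A0 + A1 * v1"
  shows "c * quad_fun r (s * (b + x)) \<le> A0 + A1 * v"
proof -
  define l where "l = (x - t0) / (t1 - t0)"
  have l: "0 \<le> l" "l \<le> 1"
    using seg by (auto simp: l_def divide_simps)
  have x: "x = (1 - l) * t0 + l * t1"
  proof -
    have "l * (t1 - t0) = x - t0"
      using seg by (simp add: l_def)
    then show ?thesis
      by (simp add: algebra_simps)
  qed
  have "s * (b + x) = (1 - l) * (s * (b + t0)) + l * (s * (b + t1))"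
    by (simp add: x algebra_simps)
  then have "c * quad_fun r (s * (b + x)) \<le>
      c * ((1 - l) * quad_fun r (s * (b + t0)) + l * quad_fun r (s * (b + t1)))"
    using quad_fun_convex[OF r l] c by (simp add: mult_left_mono)
  also have "\<dots> = (1 - l) * (c * quad_fun r (s * (b + t0))) + l * (c * quad_fun r (s * (b + t1)))"
    by (simp add: algebra_simps)
  also have "\<dots> \<le> (1 - l) * (A0 + A1 * v0) + l * (A0 + A1 * v1)"
    using 0 1 l by (intro add_mono mult_left_mono) auto
  also have "\<dots> = A0 + A1 * (v0 + (v1 - v0) * l)"
    by (simp add: algebra_simps)
  also have "\<dots> \<le> A0 + A1 * v"
    using v A1 by (intro add_mono mult_left_mono) (auto simp: l_def)
  finally show ?thesis .
qed

section \<open>Reduction to the corners of the piecewise linear bound\<close>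

definition lower_root :: "real \<Rightarrow> real" where
  "lower_root p = 1 / 2 - 1 / (4 * lower_slope p)"

text \<open>The corners of the maximum of 0 and the two lines, together with the right end of the
  unit interval. On the flat piece, monotonicity reduces everything to the corner at
  \<open>lower_root p\<close>.\<close>

definition breakpoints :: "real \<Rightarrow> (real \<times> real) set" where
  "breakpoints p = {(lower_root p, 0), (1 / 2, 1 / 4), (1, 1 / 4 + upper_slope p / 2)}"

lemma quad_fun_le_of_breakpoints:
  fixes p b :: real
  assumes p: "p \<ge> 3" and r: "1 \<le> r" "r \<le> 2" and c: "0 \<le> c" and A1: "0 \<le> A1" and s: "0 \<le> s"
    and b: "0 \<le> b" and x: "0 \<le> x" "x \<le> 1" and lines: "above_lines p x v"
    and bp: "\<And>t w. (t, w) \<in> breakpoints p \<Longrightarrow> c * quad_fun r (s * (b + t)) \<le> A0 + A1 * w"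
  shows "c * quad_fun r (s * (b + x)) \<le> A0 + A1 * v"
proof -
  have 0: "c * quad_fun r (s * (b + lower_root p)) \<le> A0 + A1 * 0"
    and 1: "c * quad_fun r (s * (b + 1 / 2)) \<le> A0 + A1 * (1 / 4)"
    and 2: "c * quad_fun r (s * (b + 1)) \<le> A0 + A1 * (1 / 4 + upper_slope p / 2)"
    by (rule bp; simp add: breakpoints_def)+
  have "(3 / 2 - 1 / (p + 1)) / (p + 1) \<le> (3 / 2) / 4"
    using p by (intro frac_le) auto
  then have slope: "lower_slope p > 0"
    unfolding lower_slope_def by argo
  have v: "0 \<le> v" "v \<ge> 1 / 4 + lower_slope p * (x - 1 / 2)" "v \<ge> 1 / 4 + upper_slope p * (x - 1 / 2)"
    using lines by (auto simp: above_lines_def)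
  consider "x \<le> lower_root p" | "lower_root p < x" "x \<le> 1 / 2" | "1 / 2 < x"
    by argo
  then show ?thesis
  proof cases
    case 1
    then have "c * quad_fun r (s * (b + x)) \<le> c * quad_fun r (s * (b + lower_root p))"
      using r c s b x by (intro mult_left_mono quad_fun_mono) auto
    also have "\<dots> \<le> A0 + A1 * v"
      using 0 v(1) A1 by (smt (verit) mult_nonneg_nonneg mult_zero_right)
    finally show ?thesis .
  next
    case 2
    have "1 / 2 - lower_root p = 1 / (4 * lower_slope p)"
      by (simp add: lower_root_def)
    moreover have "1 / 4 + lower_slope p * (x - 1 / 2) = lower_slope p * (x - lower_root p)"
      using slope by (simp add: lower_root_def field_simps)
    ultimately have "v \<ge> 0 + (1 / 4 - 0) / (1 / 2 - lower_root p) * (x - lower_root p)"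
      using v(2) by simp
    then show ?thesis
      using 2 slope by (intro quad_fun_le_on_segment[OF r(1) c A1 _ _ _ _ 0 1]) auto
  next
    case 3
    then show ?thesis
      using v(3) x by (intro quad_fun_le_on_segment[OF r(1) c A1 _ _ _ _ 1 2]) (auto simp: algebra_simps)
  qed
qed

text \<open>\<open>quad_fun s z\<close> is affine in \<open>s\<close> with slope
  \<open>z\<^sup>2 - z\<close>, so one end of an enclosure of the exponent dominates. Which one
  depends on \<open>z\<close>.\<close>

lemma powr_le_between_quad_funs:
  assumes z: "z > 0" and rho: "1 \<le> r1" "r1 \<le> \<rho>'" "\<rho>' \<le> r2" "r2 \<le> 2"
  obtains r where "r \<in> {r1, r2}" "z powr \<rho>' \<le> quad_fun r z"
proof -
  have lin: "quad_fun s z = (2 * z - z\<^sup>2) + s * (z\<^sup>2 - z)" for s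
    by (simp add: quad_fun_def algebra_simps)
  have "z powr \<rho>' \<le> quad_fun \<rho>' z"
    using assms by (intro powr_le_quad_fun) auto
  moreover have "quad_fun \<rho>' z \<le> quad_fun r2 z \<or> quad_fun \<rho>' z \<le> quad_fun r1 z"
    unfolding lin using rho by (cases "z\<^sup>2 - z \<ge> 0") (auto simp: mult_right_mono mult_right_mono_neg)
  ultimately show ?thesis
    using that[of r1] that[of r2] by auto
qed

section \<open>Lower and upper bounds for \<open>\<beta>\<close>\<close>

lemma powr_rho:
  assumes "prime p"
  shows "real p powr \<rho> p = real ((p + 1) choose 2)"
proof -
  have "p > 1" "(p + 1) choose 2 > 0"
    using prime_gt_1_nat[OF assms] by auto
  then show ?thesis
    by (simp add: \<rho>_def)
qed

lemma power_powr_rho: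
  assumes "prime p"
  shows "(real p ^ k) powr \<rho> p = real ((p + 1) choose 2) ^ k"
  using prime_gt_0_nat[OF assms] powr_rho[OF assms]
  by (simp add: powr_realpow[symmetric] powr_powr mult.commute) (simp add: powr_powr[symmetric] powr_realpow)

text \<open>Here \<open>y\<close> is the point where the infimum is approached, \<open>w\<close> the
  point where the parabola touches, and \<open>\<kappa>\<close> bounds the power of
  \<open>w / y\<close>. For leading digits up to 4 the lines are applied behind a second digit
  \<open>b\<close>, from 5 on directly behind the first.\<close>

lemma F_lower_bound:
  fixes p n :: nat and y C r1 r2 :: real
  assumes p: "prime p" "odd p" and y: "0 < y" and C: "0 \<le> C"
    and r: "1 \<le> r1" "r1 \<le> \<rho> p" "\<rho> p \<le> r2" "r2 \<le> 2"
    and small: "\<And>a::nat. a \<in> {1..4} \<Longrightarrow> \<exists>\<kappa> w. 0 < w \<and> (w / y) powr \<rho> p \<le> \<kappa> \<and>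
      (\<forall>b::nat. \<forall>(t, v)\<in>breakpoints p. \<forall>r\<in>{r1, r2}.
        \<kappa> * C * quad_fun r ((real a * real p + real b + t) / (real p * w)) \<le>
        (real a + 1) * (real a / 2 + (real b + 1) * (real b / 2 + v) / (real p * (real p + 1) / 2)))"
    and large: "\<exists>\<kappa> w. 0 < w \<and> (w / y) powr \<rho> p \<le> \<kappa> \<and>
      (\<forall>a::nat. 5 \<le> a \<longrightarrow> (\<forall>(t, v)\<in>breakpoints p. \<forall>r\<in>{r1, r2}.
        \<kappa> * C * quad_fun r ((real a + t) / w) \<le> (real a + 1) * (real a / 2 + v)))"
    and n: "n \<ge> 1"
  shows "C * y powr (- \<rho> p) \<le> F p n / n powr \<rho> p"
proof -
  define q where "q = real ((p + 1) choose 2)"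
  have p3: "real p \<ge> 3"
    using p prime_ge_2_nat[of p] by (cases "p = 2") auto
  have q: "q > 0" "q = real p * (real p + 1) / 2"
    using p3 unfolding q_def real_choose_two_Suc by simp_all
  obtain k where k: "p ^ k \<le> n" "n < p ^ Suc k"
    using ex_power_ivl1[of p n] prime_ge_2_nat[OF p(1)] n by auto
  obtain a m where am: "a < p" "m < p ^ k" "a = n div p ^ k"
    "real n / real p ^ k = real a + real m / real p ^ k"
    "real (F p n) / q ^ k = (real a + 1) * (real a / 2 + real (F p m) / q ^ k)"
    using leading_digit_decomposition[OF p(1) k(2)] unfolding q_def by metis
  define x v where "x = real m / real p ^ k" and "v = real (F p m) / q ^ k"
  have xv: "(x, v) \<in> normalised_graph p"
    unfolding normalised_graph_def x_def v_def q_def using am(2) by auto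
  note range = normalised_graph_range[OF xv]
  have a: "a \<ge> 1"
    using k am(3) p3 by (simp add: div_greater_zero_iff Suc_le_eq)
  define z where "z = a + x"
  have z: "z > 0"
    using a range by (simp add: z_def)
  \<comment> \<open>The power of \<open>z / y\<close> splits into those of \<open>w / y\<close>, at
    most \<open>\<kappa>\<close>, and of \<open>z / w\<close>, which lies below a parabola touching
    at \<open>z = w\<close>.\<close>
  have bound: "C * (z / y) powr \<rho> p \<le> R"
    if "0 < w" and \<kappa>: "(w / y) powr \<rho> p \<le> \<kappa>"
      and R: "\<And>r. r \<in> {r1, r2} \<Longrightarrow> \<kappa> * C * quad_fun r (z / w) \<le> R" for w \<kappa> R
  proof -
    obtain r where r': "r \<in> {r1, r2}" "(z / w) powr \<rho> p \<le> quad_fun r (z / w)"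
      using powr_le_between_quad_funs[of "z / w" r1 "\<rho> p" r2] r z \<open>0 < w\<close> by auto
    have "C * (z / y) powr \<rho> p = C * ((w / y) powr \<rho> p * (z / w) powr \<rho> p)"
      using z y \<open>0 < w\<close> by (simp add: powr_mult[symmetric])
    also have "\<dots> \<le> C * (\<kappa> * quad_fun r (z / w))"
      using C \<kappa> r'(2) order_trans[OF powr_ge_zero \<kappa>]
      by (intro mult_left_mono mult_mono) auto
    also have "\<dots> = \<kappa> * C * quad_fun r (z / w)"
      by simp
    also have "\<dots> \<le> R"
      using R r'(1) by blast
    finally show ?thesis .
  qed
  have main: "C * (z / y) powr \<rho> p \<le> (real a + 1) * (real a / 2 + v)"
  proof (cases "a \<le> 4")
    case True
    obtain b x' v' where b: "b < p" "(x', v') \<in> normalised_graph p" "x = (real b + x') / p"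
      "v = (real b + 1) * (b / 2 + v') / (real p * (real p + 1) / 2)"
      using normalised_graph_digit[OF p(1) xv] by metis
    note range' = normalised_graph_range[OF b(2)]
    have lines: "above_lines p x' v'"
      using normalised_graph_above_lines[OF p b(2)] .
    have "a \<in> {1..4}"
      using True a by simp
    from small[OF this] obtain \<kappa> w where w: "0 < w" "(w / y) powr \<rho> p \<le> \<kappa>"
      and check: "\<forall>b::nat. \<forall>(t, v)\<in>breakpoints p. \<forall>r\<in>{r1, r2}.
        \<kappa> * C * quad_fun r ((real a * real p + real b + t) / (real p * w)) \<le>
        (real a + 1) * (real a / 2 + (real b + 1) * (real b / 2 + v) / (real p * (real p + 1) / 2))"
      by (elim exE conjE)
    show ?thesis
    proof (rule bound[OF w])
      fix r
      assume r': "r \<in> {r1, r2}"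
      \<comment> \<open>For fixed digits the value is affine in \<open>v'\<close> with nonnegative
        slope \<open>A1\<close>, as \<open>quad_fun_le_of_breakpoints\<close> requires.\<close>
      define A0 A1 where "A0 = (real a + 1) * (real a / 2 + (real b + 1) * (real b / 2) / q)"
        and "A1 = (real a + 1) * ((real b + 1) / q)"
      have A: "A0 + A1 * u = (real a + 1) * (real a / 2 + (real b + 1) * (real b / 2 + u) / q)" for u
        unfolding A0_def A1_def by (simp add: algebra_simps add_divide_distrib)
      have "\<kappa> * C * quad_fun r (1 / (p * w) * (real (a * p + b) + x')) \<le> A0 + A1 * v'"
      proof (rule quad_fun_le_of_breakpoints[OF p3 _ _ _ _ _ _ _ _ lines])
        show "1 \<le> r" "r \<le> 2"
          using r r' by auto
        show "0 \<le> \<kappa> * C"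
          using C order_trans[OF powr_ge_zero w(2)] by simp
        show "\<kappa> * C * quad_fun r (1 / (p * w) * (real (a * p + b) + t)) \<le> A0 + A1 * u"
          if "(t, u) \<in> breakpoints p" for t u
          using bspec[OF spec[OF check, of b] that] r' unfolding A q(2) by auto
      qed (use range' w(1) q(1) in \<open>auto simp: A1_def\<close>)
      moreover have "1 / (p * w) * (real (a * p + b) + x') = z / w"
        using p3 w(1) by (simp add: z_def b(3) field_simps)
      moreover have "A0 + A1 * v' = (real a + 1) * (real a / 2 + v)"
        unfolding A b(4) q(2)[symmetric] by (simp add: add.commute)
      ultimately show "\<kappa> * C * quad_fun r (z / w) \<le> (real a + 1) * (real a / 2 + v)"
        by simp
    qed
  next
    case False
    have lines: "above_lines p x v"
      using normalised_graph_above_lines[OF p xv] .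
    from large obtain \<kappa> w where w: "0 < w" "(w / y) powr \<rho> p \<le> \<kappa>"
      and check: "\<forall>a::nat. 5 \<le> a \<longrightarrow> (\<forall>(t, v)\<in>breakpoints p. \<forall>r\<in>{r1, r2}.
        \<kappa> * C * quad_fun r ((real a + t) / w) \<le> (real a + 1) * (real a / 2 + v))"
      by (elim exE conjE)
    have a5: "5 \<le> a"
      using False by simp
    show ?thesis
    proof (rule bound[OF w])
      fix r
      assume r': "r \<in> {r1, r2}"
      have A: "(real a + 1) * (real a / 2) + (real a + 1) * u = (real a + 1) * (real a / 2 + u)" for u :: real
        by (simp add: algebra_simps)
      have "\<kappa> * C * quad_fun r (1 / w * (real a + x)) \<le> (real a + 1) * (real a / 2) + (real a + 1) * v"
      proof (rule quad_fun_le_of_breakpoints[OF p3 _ _ _ _ _ _ _ _ lines])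
        show "1 \<le> r" "r \<le> 2"
          using r r' by auto
        show "0 \<le> \<kappa> * C"
          using C order_trans[OF powr_ge_zero w(2)] by simp
        show "\<kappa> * C * quad_fun r (1 / w * (real a + t)) \<le> (real a + 1) * (real a / 2) + (real a + 1) * u"
          if "(t, u) \<in> breakpoints p" for t u
          using bspec[OF mp[OF spec[OF check, of a] a5] that] r' unfolding A by auto
      qed (use range w(1) in auto)
      then show "\<kappa> * C * quad_fun r (z / w) \<le> (real a + 1) * (real a / 2 + v)"
        unfolding A z_def by simp
    qed
  qed
  have pw: "(real p ^ k) powr \<rho> p = q ^ k"
    unfolding q_def by (rule power_powr_rho[OF p(1)])
  have nz: "real n = real p ^ k * z"
    using am(4) p3 by (simp add: z_def x_def field_simps)
  have Fq: "real (F p n) = q ^ k * ((real a + 1) * (real a / 2 + v))"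
    unfolding v_def am(5)[symmetric] using q(1) by simp
  have "C * y powr (- \<rho> p) = C * (z / y) powr \<rho> p / z powr \<rho> p"
    using y z by (simp add: powr_divide powr_minus field_simps)
  also have "\<dots> \<le> (real a + 1) * (real a / 2 + v) / z powr \<rho> p"
    using main by (intro divide_right_mono) auto
  also have "\<dots> = F p n / n powr \<rho> p"
    using q(1) z p3 unfolding nz Fq
    by (simp add: powr_mult pw)
  finally show ?thesis .
qed

text \<open>\<open>h\<close> consists of \<open>j\<close> digits \<open>(p - 1) / 2\<close>, and its
  point on the normalised graph tends to \<open>(1/2, 1/4)\<close>.\<close>

lemma F_all_middle_digits:
  assumes p: "prime p" "odd p" and h: "2 * h + 1 = p ^ j"
  shows "real (F p h) = real ((p + 1) choose 2) ^ j * (1 - 1 / real p ^ j) / 4"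
  using h
proof (induction j arbitrary: h)
  case 0
  then show ?case
    by (simp add: F_def)
next
  case (Suc j)
  obtain c where c: "p = 2 * c + 1"
    using p by (elim oddE)
  have "odd (p ^ j)"
    using p by simp
  then obtain h' where h': "p ^ j = 2 * h' + 1"
    by (elim oddE)
  have IH: "real (F p h') = real ((p + 1) choose 2) ^ j * (1 - 1 / real p ^ j) / 4"
    using Suc.IH h' by simp
  have "2 * h + 1 = 2 * (c * p ^ j + h') + 1"
    using Suc.prems h' by (simp add: c algebra_simps)
  then have "h = c * p ^ j + h'"
    by simp
  then have "real (F p h) = real c * (real c + 1) / 2 * real ((p + 1) choose 2) ^ j +
      (real c + 1) * real (F p h')"
    using F_leading_digit[OF p(1), of c h' j] h' by (simp add: c)
  also have "\<dots> = real ((p + 1) choose 2) ^ j *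
      (real c * (real c + 1) / 2 + (real c + 1) * ((1 - 1 / real p ^ j) / 4))"
    unfolding IH by (simp add: algebra_simps)
  also have "real c * (real c + 1) / 2 + (real c + 1) * ((1 - 1 / real p ^ j) / 4) =
      real ((p + 1) choose 2) * ((1 - 1 / real p ^ Suc j) / 4)"
  proof -
    have q: "real ((p + 1) choose 2) = (real c + 1) * real p"
      unfolding real_choose_two_Suc by (simp add: c)
    have "real p * (1 - 1 / real p ^ Suc j) = 2 * real c + 1 - 1 / real p ^ j"
      using p by (simp add: c right_diff_distrib)
    then have "real ((p + 1) choose 2) * ((1 - 1 / real p ^ Suc j) / 4) =
        (real c + 1) * (2 * real c + 1 - 1 / real p ^ j) / 4"
      unfolding q by simp
    moreover have "real c * (real c + 1) / 2 + (real c + 1) * ((1 - u) / 4) =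
        (real c + 1) * (2 * real c + 1 - u) / 4" for u
      by (simp add: field_simps)
    ultimately show ?thesis
      by simp
  qed
  finally show ?case
    by (simp add: mult.assoc mult.commute)
qed

text \<open>The numbers \<open>N j\<close> with digits \<open>x\<close>, \<open>d\<close> and then
  \<open>j\<close> middle digits each bound the infimum; the claim is the limit for growing
  \<open>j\<close>.\<close>

lemma \<beta>_upper_bound:
  fixes p x d :: nat
  assumes p: "prime p" "odd p" and x: "1 \<le> x" "x < p" and d: "d < p"
  shows "\<beta> p \<le> (real x + 1) * (real x / 2 + (real d + 1) * (2 * real d + 1) / (2 * real p * (real p + 1))) *
    (real x + (2 * real d + 1) / (2 * real p)) powr (- \<rho> p)"
    (is "_ \<le> ?C * ?y powr _")
proof -
  define q where "q = real ((p + 1) choose 2)"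
  define h where "h j = (p ^ j - 1) div 2" for j
  define N where "N j = x * p ^ Suc j + (d * p ^ j + h j)" for j
  have p0: "p > 0" and p1: "real p > 1"
    using prime_gt_1_nat[OF p(1)] by auto
  have q: "q > 0" "q = real p * (real p + 1) / 2"
    using p0 unfolding q_def real_choose_two_Suc by simp_all
  have h: "2 * h j + 1 = p ^ j" for j
  proof -
    have "odd (p ^ j)"
      using p by simp
    then show ?thesis
      unfolding h_def by presburger
  qed
  have hr: "real (h j) = (real p ^ j - 1) / 2" for j
  proof -
    have "real (2 * h j + 1) = real p ^ j"
      unfolding h by simp
    then show ?thesis
      by simp
  qed
  have less: "d * p ^ j + h j \<le> p ^ Suc j" for j
  proof -
    have "(d + 1) * p ^ j \<le> p * p ^ j"
      using d by (intro mult_right_mono) auto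
    then show ?thesis
      using h[of j] by simp
  qed
  have hp: "h j \<le> p ^ j" for j
    using h[of j] by simp
  have N: "real (N j) / real p ^ Suc j = real x + (2 * real d + 1 - (1 / real p) ^ j) / (2 * real p)" for j
    using p1 unfolding N_def by (simp add: hr field_simps)
  have FN: "real (F p (N j)) / q ^ Suc j = (real x + 1) * (real x / 2 +
      (real d + 1) * (2 * real d + 1 - (1 / real p) ^ j) / (2 * real p * (real p + 1)))" for j
  proof -
    have "real (F p (N j)) = real x * (real x + 1) / 2 * q ^ Suc j + (real x + 1) *
        (real d * (real d + 1) / 2 * q ^ j + (real d + 1) * (q ^ j * (1 - 1 / real p ^ j) / 4))"
      unfolding N_def F_leading_digit[OF p(1) x(2) less] F_leading_digit[OF p(1) d hp]
        F_all_middle_digits[OF p h] q_def by simp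
    also have "\<dots> = q ^ Suc j * ((real x + 1) * (real x / 2 +
      (real d + 1) * (2 * real d + 1 - (1 / real p) ^ j) / (4 * q)))"
      using q(1) by (simp add: field_simps)
    finally show ?thesis
      using q(1) p0 unfolding q(2) by simp
  qed
  have ratio: "\<beta> p \<le> (real x + 1) * (real x / 2 +
      (real d + 1) * (2 * real d + 1 - (1 / real p) ^ j) / (2 * real p * (real p + 1))) *
      (real x + (2 * real d + 1 - (1 / real p) ^ j) / (2 * real p)) powr (- \<rho> p)" for j
  proof -
    have pw: "(real p ^ Suc j) powr \<rho> p = q ^ Suc j"
      unfolding q_def by (rule power_powr_rho[OF p(1)])
    have N1: "N j \<ge> 1"
      using x p0 unfolding N_def by (simp add: Suc_le_eq)
    have "\<beta> p \<le> real (F p (N j)) / real (N j) powr \<rho> p"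
      unfolding \<beta>_def using N1 by (intro cINF_lower bdd_belowI[of _ 0]) auto
    also have "real (N j) = real p ^ Suc j * (real (N j) / real p ^ Suc j)"
      using p0 by simp
    also have "real (F p (N j)) / \<dots> powr \<rho> p =
        real (F p (N j)) / q ^ Suc j * (real (N j) / real p ^ Suc j) powr (- \<rho> p)"
      using p0 q(1) by (subst powr_mult)
        (simp_all add: pw powr_minus divide_simps del: power_Suc)
    finally show ?thesis
      unfolding N FN .
  qed
  \<comment> \<open>A positive limit of the base makes \<open>powr\<close> continuous there.\<close>
  have y: "?y > 0"
    using x by (intro add_pos_nonneg) auto
  have lim: "(\<lambda>j. (1 / real p) ^ j) \<longlonglongrightarrow> 0"
    using p1 by (intro LIMSEQ_power_zero) auto
  have "(\<lambda>j. (real x + 1) * (real x / 2 +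
      (real d + 1) * (2 * real d + 1 - (1 / real p) ^ j) / (2 * real p * (real p + 1))) *
      (real x + (2 * real d + 1 - (1 / real p) ^ j) / (2 * real p)) powr (- \<rho> p)) \<longlonglongrightarrow>
      (real x + 1) * (real x / 2 + (real d + 1) * (2 * real d + 1 - 0) / (2 * real p * (real p + 1))) *
      (real x + (2 * real d + 1 - 0) / (2 * real p)) powr (- \<rho> p)"
    using y p0 by (intro tendsto_intros lim) auto
  then show ?thesis
    using ratio by (intro LIMSEQ_le_const) auto
qed

section \<open>Reduction to integer arithmetic\<close>

text \<open>A triple \<open>(S, T, V)\<close> encodes the breakpoint \<open>(T / S, V / S)\<close>.\<close>

definition int_breakpoints :: "int \<Rightarrow> (int \<times> int \<times> int) list" where
  "int_breakpoints p =
     (let P = p + 1; E = 2 * P\<^sup>2 - 3 * P + 2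
      in [(2 * E, E - P\<^sup>2, 0), (4, 2, 1), (4 * P, 4 * P, 3 * P + 1)])"

lemma breakpoints_eq_int_breakpoints:
  fixes p :: int
  assumes "p \<ge> 3" "(t, v) \<in> breakpoints p"
  shows "\<exists>S T V. (S, T, V) \<in> set (int_breakpoints p) \<and> S > 0 \<and> t = T / S \<and> v = V / S"
proof -
  define P where "P = real_of_int p + 1"
  define E where "E = 2 * P\<^sup>2 - 3 * P + 2"
  have P: "P \<ge> 4"
    using assms(1) by (simp add: P_def)
  have "E = 2 * P * (P - 4) + 5 * P + 2"
    by (simp add: E_def power2_eq_square algebra_simps)
  moreover have "0 \<le> 2 * P * (P - 4)"
    using P by (intro mult_nonneg_nonneg) auto
  ultimately have E: "E > 0"
    using P by argo
  have slope: "lower_slope p = E / (2 * P\<^sup>2)"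
    using P unfolding lower_slope_def P_def[symmetric] E_def by (simp add: field_simps power2_eq_square)
  have root: "lower_root p = (E - P\<^sup>2) / (2 * E)"
    using E P unfolding lower_root_def slope by (simp add: field_simps)
  have top: "1 / 4 + upper_slope p / 2 = (3 * P + 1) / (4 * P)"
    using P unfolding upper_slope_def P_def[symmetric] by (simp add: field_simps)
  define E' where "E' = 2 * (p + 1)\<^sup>2 - 3 * (p + 1) + 2"
  have E': "real_of_int E' = E" "E' > 0"
  proof -
    show "real_of_int E' = E"
      by (simp add: E'_def E_def P_def)
    with E show "E' > 0"
      by simp
  qed
  have set: "set (int_breakpoints p) =
      {(2 * E', E' - (p + 1)\<^sup>2, 0), (4, 2, 1), (4 * (p + 1), 4 * (p + 1), 3 * (p + 1) + 1)}"
    by (simp only: int_breakpoints_def Let_def E'_def[symmetric] list.set)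
  from assms(2) consider "t = lower_root p" "v = 0" | "t = 1 / 2" "v = 1 / 4"
    | "t = 1" "v = 1 / 4 + upper_slope p / 2"
    by (auto simp: breakpoints_def)
  then show ?thesis
  proof cases
    case 1
    then have "t = of_int (E' - (p + 1)\<^sup>2) / of_int (2 * E')" "v = of_int 0 / of_int (2 * E')"
      using root E' by (simp_all add: P_def)
    moreover have "(2 * E', E' - (p + 1)\<^sup>2, 0) \<in> set (int_breakpoints p)" "0 < 2 * E'"
      using E'(2) unfolding set by simp_all
    ultimately show ?thesis
      by blast
  next
    case 2
    then have "t = of_int 2 / of_int 4" "v = of_int 1 / of_int 4"
      by simp_all
    moreover have "(4, 2, 1) \<in> set (int_breakpoints p)" "(0::int) < 4"
      unfolding set by simp_all
    ultimately show ?thesis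
      by blast
  next
    case 3
    then have "t = of_int (4 * (p + 1)) / of_int (4 * (p + 1))" "v = of_int (3 * (p + 1) + 1) / of_int (4 * (p + 1))"
      using top assms(1) by (simp_all add: P_def)
    moreover have "(4 * (p + 1), 4 * (p + 1), 3 * (p + 1) + 1) \<in> set (int_breakpoints p)" "0 < 4 * (p + 1)"
      using assms(1) unfolding set by simp_all
    ultimately show ?thesis
      by blast
  qed
qed

definition nonneg_at_vertex :: "int \<Rightarrow> int \<Rightarrow> int \<Rightarrow> int \<Rightarrow> bool" where
  "nonneg_at_vertex f2 f1 f0 m \<longleftrightarrow> 0 \<le> (f2 * m + f1) * m + f0 \<and> 0 \<le> (f2 * (m + 1) + f1) * (m + 1) + f0"

text \<open>The real vertex \<open>- f1 / (2 * f2)\<close> lies between \<open>m\<close> and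
  \<open>m + 1\<close>, so the minimum over the integers is attained at one of these two. The real
  quadratic may still be negative between them.\<close>

definition quadratic_nonneg :: "int \<times> int \<times> int \<Rightarrow> bool" where
  "quadratic_nonneg = (\<lambda>(f2, f1, f0). 0 < f2 \<and> nonneg_at_vertex f2 f1 f0 ((- f1) div (2 * f2)))"

lemma quadratic_nonneg_imp:
  assumes "quadratic_nonneg (f2, f1, f0)"
  shows "0 \<le> (f2 * b + f1) * b + f0"
proof -
  define f where "f b = (f2 * b + f1) * b + f0" for b
  define m where "m = (- f1) div (2 * f2)"
  have *: "0 < f2" "0 \<le> f m" "0 \<le> f (m + 1)"
    using assms by (auto simp: quadratic_nonneg_def nonneg_at_vertex_def f_def m_def)
  have m: "2 * f2 * m \<le> - f1" "- f1 < 2 * f2 * (m + 1)"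
  proof -
    have "- f1 = 2 * f2 * m + (- f1) mod (2 * f2)"
      unfolding m_def by simp
    moreover have "0 \<le> (- f1) mod (2 * f2)" "(- f1) mod (2 * f2) < 2 * f2"
      using * by simp_all
    ultimately show "2 * f2 * m \<le> - f1" "- f1 < 2 * f2 * (m + 1)"
      by (simp_all add: algebra_simps)
  qed
  have "0 \<le> f b"
  proof (cases "b \<le> m")
    case True
    have "f2 * (b + m) \<le> f2 * (m + m)"
      using True * by (intro mult_left_mono) auto
    then have "f2 * (b + m) + f1 \<le> 0"
      using m(1) by (simp only: algebra_simps mult_2)
    then have "0 \<le> (b - m) * (f2 * (b + m) + f1)"
      using True by (intro mult_nonpos_nonpos) auto
    also have "\<dots> = f b - f m"
      by (simp add: f_def algebra_simps)
    finally show ?thesis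
      using * by simp
  next
    case False
    have "f2 * (m + 1 + (m + 1)) \<le> f2 * (b + (m + 1))"
      using False * by (intro mult_left_mono) auto
    then have "0 \<le> f2 * (b + (m + 1)) + f1"
      using m(2) by (simp only: algebra_simps mult_2)
    then have "0 \<le> (b - (m + 1)) * (f2 * (b + (m + 1)) + f1)"
      using False by (intro mult_nonneg_nonneg) auto
    also have "\<dots> = f b - f (m + 1)"
      by (simp add: f_def algebra_simps)
    finally show ?thesis
      using * by simp
  qed
  then show ?thesis
    by (simp add: f_def)
qed

text \<open>The conditions are the signs of the Taylor coefficients at 5.\<close>

definition quadratic_nonneg_from_5 :: "int \<times> int \<times> int \<Rightarrow> bool" where
  "quadratic_nonneg_from_5 = (\<lambda>(f2, f1, f0). 0 \<le> f2 \<and> 0 \<le> 10 * f2 + f1 \<and> 0 \<le> (5 * f2 + f1) * 5 + f0)"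

lemma quadratic_nonneg_from_5_imp:
  assumes "quadratic_nonneg_from_5 (f2, f1, f0)" "5 \<le> a"
  shows "0 \<le> (f2 * a + f1) * a + f0"
proof -
  have *: "0 \<le> f2" "0 \<le> 10 * f2 + f1" "0 \<le> (5 * f2 + f1) * 5 + f0"
    using assms(1) by (auto simp: quadratic_nonneg_from_5_def)
  have "0 \<le> f2 * (a - 5)\<^sup>2 + (10 * f2 + f1) * (a - 5) + ((5 * f2 + f1) * 5 + f0)"
    using assms(2) by (intro add_nonneg_nonneg[OF add_nonneg_nonneg *(3)] mult_nonneg_nonneg *(1,2)) simp_all
  also have "\<dots> = (f2 * a + f1) * a + f0"
    by (simp add: power2_eq_square algebra_simps)
  finally show ?thesis .
qed

text \<open>\<open>N\<close> is quadratic and \<open>X\<close> affine in a digit, so a comparison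
  for all values of that digit becomes a condition on three integers.\<close>

definition margin_coeffs ::
  "int \<Rightarrow> int \<Rightarrow> int \<Rightarrow> int \<times> int \<times> int \<Rightarrow> int \<times> int \<Rightarrow> int \<times> int \<times> int" where
  "margin_coeffs L G1 G2 = (\<lambda>(N2, N1, N0) (X1, X0).
     (L * N2 - G2 * X1\<^sup>2, L * N1 - X1 * (G1 + 2 * G2 * X0), L * N0 - X0 * (G1 + G2 * X0)))"

lemma margin_coeffs_eval:
  assumes "margin_coeffs L G1 G2 (N2, N1, N0) (X1, X0) = (f2, f1, f0)"
    and "N = (N2 * b + N1) * b + N0" "X = X1 * b + X0"
  shows "(f2 * b + f1) * b + f0 = L * N - X * (G1 + G2 * X)"
proof -
  have f: "f2 = L * N2 - G2 * X1\<^sup>2" "f1 = L * N1 - X1 * (G1 + 2 * G2 * X0)" "f0 = L * N0 - X0 * (G1 + G2 * X0)"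
    using assms(1) by (auto simp: margin_coeffs_def)
  show ?thesis
    unfolding f assms(2,3) by (simp add: power2_eq_square algebra_simps)
qed

text \<open>The margin is the amount by which a value \<open>N / (2 Q S)\<close> exceeds the tangent parabola
  \<open>K / M * c / (4 Q) * quad_fun r z\<close>, with denominators cleared.\<close>

lemma margin_nonneg_imp:
  fixes z :: real and K M c k m S W N X v Q :: int
  assumes nonneg: "0 \<le> 2 * M * m * S * W\<^sup>2 * N - X * (2 * K * c * (m - k) * S * W * v + 4 * K * c * k * v\<^sup>2 * X)"
    and pos: "0 < W" "0 < m" "0 < S" "0 < Q" "0 < M" and z: "z * W * S = 2 * real_of_int v * real_of_int X"
  shows "K / M * (c / (4 * Q)) * quad_fun (1 + k / m) z \<le> N / (2 * Q * S)"
proof -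
  define g where "g = 2 * real_of_int M * m * N -
    real_of_int K * c * S * ((real_of_int m - k) * z + k * z\<^sup>2)"
  have "real_of_int (2 * M * m * S * W\<^sup>2 * N -
        X * (2 * K * c * (m - k) * S * W * v + 4 * K * c * k * v\<^sup>2 * X)) =
      real_of_int S * (real_of_int W)\<^sup>2 * (2 * real_of_int M * m * N) -
      real_of_int K * c * ((real_of_int m - k) * S * W * (2 * real_of_int v * real_of_int X) +
        k * (2 * real_of_int v * real_of_int X)\<^sup>2)"
    by (simp add: power2_eq_square algebra_simps)
  also have "\<dots> = real_of_int S * (real_of_int W)\<^sup>2 * g"
    unfolding z[symmetric] g_def by (simp add: power2_eq_square algebra_simps)
  finally have "0 \<le> real_of_int S * (real_of_int W)\<^sup>2 * g"
    using nonneg by (metis of_int_0_le_iff)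
  moreover have "0 < real_of_int S * (real_of_int W)\<^sup>2"
    using pos by simp
  ultimately have g: "0 \<le> g"
    by (metis zero_le_mult_iff not_less)
  have "N / (2 * Q * S) - K / M * (c / (4 * Q)) * quad_fun (1 + k / m) z =
      g / (4 * real_of_int Q * S * M * m)"
    using pos by (simp add: g_def quad_fun_def field_simps)
  also have "\<dots> \<ge> 0"
    using g pos by simp
  finally show ?thesis
    by simp
qed

text \<open>The entry \<open>(a, u, v, K, M)\<close> prescribes, for numbers with leading digit \<open>a\<close>, the parabola
  touching the power function at \<open>u / v\<close> times the point \<open>\<xi> + 1 / 2 - \<eta> / p\<close> where the infimum is
  approached, and \<open>K / M\<close> bounds \<open>(u / v) powr \<rho> p\<close>. The leading digits from 5 on share
  one parabola. The fractions were found by a numerical search.\<close>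

definition small_tangents :: "int \<Rightarrow> (int \<times> int \<times> int \<times> int \<times> int) list" where
  "small_tangents x =
     (if x = 1 then [(1, 1, 1, 1, 1), (2, 5, 3, 5, 2), (3, 7, 3, 14, 3), (4, 3, 1, 15, 2)]
      else [(1, 3, 5, 63, 158), (2, 1, 1, 1, 1), (3, 11, 8, 65, 36), (4, 9, 5, 3, 1)])"

definition large_tangent :: "int \<Rightarrow> int \<times> int \<times> int \<times> int" where
  "large_tangent x = (if x = 1 then (7, 2, 10, 1) else (2, 1, 29, 8))"

text \<open>The exponent is rounded to the rational \<open>n / m\<close>, upwards for
  \<open>u \<ge> 1\<close> and downwards for \<open>u \<le> 1\<close>; raising to the power
  \<open>m\<close> then leaves only natural exponents.\<close>

lemma powr_le_of_power_le:
  fixes u \<kappa> r :: real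
  assumes "0 < u" "0 \<le> \<kappa>" "0 < m" "u ^ n \<le> \<kappa> ^ m"
    and "1 \<le> u \<and> r \<le> n / m \<or> u \<le> 1 \<and> n / m \<le> r"
  shows "u powr r \<le> \<kappa>"
proof -
  have "u powr r \<le> u powr (n / m)"
    using assms by (auto intro: powr_mono powr_mono')
  moreover have "(u powr (n / m)) ^ m \<le> \<kappa> ^ m"
    using assms by (simp add: powr_powr powr_realpow flip: powr_realpow)
  then have "u powr (n / m) \<le> \<kappa>"
    using assms by (simp add: power_mono_iff)
  ultimately show ?thesis
    by simp
qed

text \<open>The limits for \<open>r\<close> come from the enclosures of \<open>\<rho> p\<close> used
  below: \<open>52 / 29\<close> from \<open>p = 23\<close>, \<open>141 / 76\<close> from
  \<open>p = 113\<close>, and \<open>9 / 5\<close> is the least lower bound occurring with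
  \<open>x = 2\<close>.\<close>

lemma tangents_bound:
  fixes r :: real
  assumes "x = 1 \<and> r \<le> 52 / 29 \<or> x = 2 \<and> 9 / 5 \<le> r \<and> r \<le> 141 / 76"
    and "(a, u, v, K, M) \<in> set (small_tangents x) \<or> (u, v, K, M) = large_tangent x"
  shows "0 < u \<and> 0 < v \<and> 0 < M \<and> (u / v) powr r \<le> K / M"
proof -
  \<comment> \<open>All ratios exceed 1, so only the upper limit matters. The rounder exponent
    \<open>9 / 5\<close> serves three of them, but \<open>(5 / 3) powr (9 / 5)\<close> is already
    above \<open>5 / 2\<close>.\<close>
  have 1: "(5 / 3) powr r \<le> 5 / 2" "(7 / 3) powr r \<le> 14 / 3" "3 powr r \<le> 15 / 2" "(7 / 2) powr r \<le> 10"
    if "r \<le> 52 / 29"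
    using that powr_le_of_power_le[of "5 / 3" "5 / 2" 29 52 r] powr_le_of_power_le[of "7 / 3" "14 / 3" 5 9 r]
      powr_le_of_power_le[of 3 "15 / 2" 5 9 r] powr_le_of_power_le[of "7 / 2" 10 5 9 r]
    by (simp_all add: power_divide)
  \<comment> \<open>\<open>3 / 5\<close> is below 1 and uses the lower limit. For
    \<open>11 / 8\<close> the exponent \<open>13 / 7\<close> would exceed the bound
    \<open>65 / 36\<close>.\<close>
  have 2: "(3 / 5) powr r \<le> 63 / 158" "(11 / 8) powr r \<le> 65 / 36" "(9 / 5) powr r \<le> 3" "2 powr r \<le> 29 / 8"
    if "9 / 5 \<le> r" "r \<le> 141 / 76"
    using that powr_le_of_power_le[of "3 / 5" "63 / 158" 5 9 r] powr_le_of_power_le[of "11 / 8" "65 / 36" 76 141 r]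
      powr_le_of_power_le[of "9 / 5" 3 7 13 r] powr_le_of_power_le[of 2 "29 / 8" 7 13 r]
    by (simp_all add: power_divide)
  show ?thesis
    using assms 1 2 by (auto simp: small_tangents_def large_tangent_def)
qed

text \<open>The margin as a quadratic in the second digit for leading digit \<open>a\<close>. The
  exponent is \<open>1 + k / m\<close>, the limit point is \<open>Y / (2 * p)\<close>, and
  \<open>c / (4 * p * (p + 1))\<close> is the factor in front of the power in
  \<open>B\<close>.\<close>

definition second_digit_ok ::
  "int \<Rightarrow> int \<Rightarrow> int \<Rightarrow> int \<times> int \<Rightarrow> int \<times> int \<times> int \<times> int \<times> int \<Rightarrow> int \<times> int \<times> int \<Rightarrow> bool" where
  "second_digit_ok p Y c = (\<lambda>(k, m) (a, u, v, K, M) (S, T, V).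
     quadratic_nonneg
       (margin_coeffs (2 * M * m * S * (Y * u)\<^sup>2 * (a + 1)) (2 * K * c * (m - k) * S * Y * u * v) (4 * K * c * k * v\<^sup>2)
         (2 * S, 2 * S + 4 * V, a * p * (p + 1) * S + 4 * V) (S, a * p * S + T)))"

text \<open>The same margin as a quadratic in the leading digit itself.\<close>

definition first_digit_ok ::
  "int \<Rightarrow> int \<Rightarrow> int \<Rightarrow> int \<times> int \<Rightarrow> int \<times> int \<times> int \<times> int \<Rightarrow> int \<times> int \<times> int \<Rightarrow> bool" where
  "first_digit_ok p Y c = (\<lambda>(k, m) (u, v, K, M) (S, T, V).
     quadratic_nonneg_from_5
       (margin_coeffs (2 * M * m * S * (Y * u)\<^sup>2 * p * (p + 1)) (2 * K * c * (m - k) * S * Y * u * v) (4 * K * c * k * v\<^sup>2)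
         (S, S + 2 * V, 2 * V) (p * S, p * T)))"

definition digits_ok :: "int \<Rightarrow> int \<Rightarrow> int \<Rightarrow> int \<Rightarrow> (int \<times> int) list \<Rightarrow> bool" where
  "digits_ok p x Y c rs \<longleftrightarrow>
     list_all (\<lambda>r. list_all (\<lambda>b. first_digit_ok p Y c r (large_tangent x) b \<and>
       list_all (\<lambda>w. second_digit_ok p Y c r w b) (small_tangents x)) (int_breakpoints p)) rs"

text \<open>Since \<open>\<rho> p - 1\<close> is the logarithm of \<open>(p + 1) / 2\<close> to base \<open>p\<close>, this encloses it between
  \<open>k1 / m1\<close> and \<open>k2 / m2\<close>.\<close>

definition rho_bounds_ok :: "int \<Rightarrow> nat \<Rightarrow> nat \<Rightarrow> nat \<Rightarrow> nat \<Rightarrow> bool" where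
  "rho_bounds_ok p k1 m1 k2 m2 \<longleftrightarrow> 0 < m1 \<and> 0 < m2 \<and> k2 \<le> m2 \<and>
     p ^ k1 \<le> ((p + 1) div 2) ^ m1 \<and> ((p + 1) div 2) ^ m2 \<le> p ^ k2"

lemma rho_bounds:
  assumes p: "prime p" "odd p" and ok: "rho_bounds_ok (int p) k1 m1 k2 m2"
  shows "1 + k1 / m1 \<le> \<rho> p" "\<rho> p \<le> 1 + k2 / m2"
proof -
  obtain c where c: "p = 2 * c + 1"
    using p by (elim oddE)
  define h where "h = c + 1"
  have p1: "real p > 1"
    using prime_gt_1_nat[OF p(1)] by simp
  have h0: "real h > 0"
    by (simp add: h_def)
  have "(int p + 1) div 2 = int h"
    by (simp add: c h_def)
  then have ok': "m1 > 0" "m2 > 0" "int p ^ k1 \<le> int h ^ m1" "int h ^ m2 \<le> int p ^ k2"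
    using ok by (simp_all add: rho_bounds_ok_def)
  have pows: "real p ^ k1 \<le> real h ^ m1" "real h ^ m2 \<le> real p ^ k2"
    using ok'(3,4) by (metis of_int_le_iff of_int_of_nat_eq of_int_power)+
  have "real ((p + 1) choose 2) = real p * real h"
    unfolding real_choose_two_Suc by (simp add: c h_def)
  then have rho: "\<rho> p = 1 + log p h"
    using p1 h0 by (simp add: \<rho>_def log_mult)
  have "real k1 \<le> m1 * log p h"
    using pows(1) p1 h0 by (simp add: log_nat_power[symmetric] le_log_iff powr_realpow)
  then show "1 + k1 / m1 \<le> \<rho> p"
    using ok' by (simp add: rho field_simps)
  have "m2 * log p h \<le> real k2"
    using pows(2) p1 h0 by (simp add: log_nat_power[symmetric] log_le_iff powr_realpow)
  then show "\<rho> p \<le> 1 + k2 / m2"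
    using ok' by (simp add: rho field_simps)
qed

lemma second_digit_ok_imp:
  fixes a b p :: nat
  assumes ok: "second_digit_ok (int p) Y c (k, m) (int a, u, v, K, M) (S, T, V)"
    and pos: "0 < p" "0 < Y" "0 < m" "0 < S" "0 < u" "0 < v" "0 < M"
    and t: "t = T / S" and w: "w = V / S"
  shows "K / M * (c / (4 * (real p * (real p + 1)))) *
      quad_fun (1 + k / m) ((real a * real p + real b + t) / (real p * (Y / (2 * real p) * (u / v)))) \<le>
    (real a + 1) * (real a / 2 + (real b + 1) * (real b / 2 + w) / (real p * (real p + 1) / 2))"
proof -
  define Q where "Q = int p * (int p + 1)"
  define z where "z = (real a * real p + real b + t) / (real p * (Y / (2 * real p) * (u / v)))"
  define X where "X = S * int b + (int a * int p * S + T)"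
  define N where "N = (2 * S * int b + (2 * S + 4 * V)) * int b + (int a * int p * (int p + 1) * S + 4 * V)"
  obtain f2 f1 f0 where f: "margin_coeffs (2 * M * m * S * (Y * u)\<^sup>2 * (int a + 1))
      (2 * K * c * (m - k) * S * Y * u * v) (4 * K * c * k * v\<^sup>2)
      (2 * S, 2 * S + 4 * V, int a * int p * (int p + 1) * S + 4 * V) (S, int a * int p * S + T) = (f2, f1, f0)"
    using prod_cases3 by blast
  have "0 \<le> (f2 * int b + f1) * int b + f0"
    using ok by (intro quadratic_nonneg_imp) (simp add: second_digit_ok_def f)
  then have "0 \<le> 2 * M * m * S * (Y * u)\<^sup>2 * ((int a + 1) * N) -
      X * (2 * K * c * (m - k) * S * (Y * u) * v + 4 * K * c * k * v\<^sup>2 * X)"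
    unfolding margin_coeffs_eval[OF f N_def X_def] by (simp add: mult.assoc)
  moreover have "z * of_int (Y * u) * S = 2 * of_int v * of_int X"
    using pos by (simp add: z_def X_def t field_simps)
  moreover have "0 < Y * u" "0 < Q"
    using pos by (simp_all add: Q_def)
  ultimately have "K / M * (c / (4 * Q)) * quad_fun (1 + k / m) z \<le> of_int ((int a + 1) * N) / (2 * Q * S)"
    using pos by (intro margin_nonneg_imp[where W = "Y * u" and v = v and X = X]) auto
  also have "of_int ((int a + 1) * N) / (2 * Q * S) =
      (real a + 1) * (real a / 2 + (real b + 1) * (real b / 2 + w) / (real p * (real p + 1) / 2))"
  proof -
    have V: "real_of_int V = w * S"
      using pos w by simp
    have "real_of_int N = S * (real a * Q + (real b + 1) * (2 * real b + 4 * w))"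
      by (simp add: N_def Q_def V algebra_simps)
    then have "of_int ((int a + 1) * N) / (2 * Q * S) =
        (real a + 1) * ((real a * Q + (real b + 1) * (2 * real b + 4 * w)) / (2 * Q))"
      using pos by simp
    also have "(real a * Q + (real b + 1) * (2 * real b + 4 * w)) / (2 * Q) =
        real a / 2 + (real b + 1) * (real b / 2 + w) / (Q / 2)"
      using \<open>0 < Q\<close> by (simp add: field_simps)
    finally show ?thesis
      by (simp add: Q_def)
  qed
  finally show ?thesis
    by (simp add: z_def Q_def)
qed

lemma first_digit_ok_imp:
  fixes a p :: nat
  assumes ok: "first_digit_ok (int p) Y c (k, m) (u, v, K, M) (S, T, V)" and a: "5 \<le> a"
    and pos: "0 < p" "0 < Y" "0 < m" "0 < S" "0 < u" "0 < v" "0 < M"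
    and t: "t = T / S" and w: "w = V / S"
  shows "K / M * (c / (4 * (real p * (real p + 1)))) *
      quad_fun (1 + k / m) ((real a + t) / (Y / (2 * real p) * (u / v))) \<le>
    (real a + 1) * (real a / 2 + w)"
proof -
  define Q where "Q = int p * (int p + 1)"
  define z where "z = (real a + t) / (Y / (2 * real p) * (u / v))"
  define X where "X = int p * S * int a + int p * T"
  define N where "N = (S * int a + (S + 2 * V)) * int a + 2 * V"
  obtain f2 f1 f0 where f: "margin_coeffs (2 * M * m * S * (Y * u)\<^sup>2 * int p * (int p + 1))
      (2 * K * c * (m - k) * S * Y * u * v) (4 * K * c * k * v\<^sup>2)
      (S, S + 2 * V, 2 * V) (int p * S, int p * T) = (f2, f1, f0)"
    using prod_cases3 by blast
  have "0 \<le> (f2 * int a + f1) * int a + f0"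
    using ok a by (intro quadratic_nonneg_from_5_imp) (simp_all add: first_digit_ok_def f)
  then have "0 \<le> 2 * M * m * S * (Y * u)\<^sup>2 * (Q * N) -
      X * (2 * K * c * (m - k) * S * (Y * u) * v + 4 * K * c * k * v\<^sup>2 * X)"
    unfolding margin_coeffs_eval[OF f N_def X_def] by (simp add: Q_def mult.assoc)
  moreover have "z * of_int (Y * u) * S = 2 * of_int v * of_int X"
    using pos by (simp add: z_def X_def t field_simps)
  moreover have "0 < Y * u" "0 < Q"
    using pos by (simp_all add: Q_def)
  ultimately have "K / M * (c / (4 * Q)) * quad_fun (1 + k / m) z \<le> of_int (Q * N) / (2 * Q * S)"
    using pos by (intro margin_nonneg_imp[where W = "Y * u" and v = v and X = X]) auto
  also have "of_int (Q * N) / (2 * Q * S) = (real a + 1) * (real a / 2 + w)"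
  proof -
    have V: "real_of_int V = w * S"
      using pos w by simp
    have "real_of_int N = S * ((real a + 1) * (real a + 2 * w))"
      by (simp add: N_def V algebra_simps)
    then show ?thesis
      using pos \<open>0 < Q\<close> by (simp add: field_simps)
  qed
  finally show ?thesis
    by (simp add: z_def Q_def)
qed

text \<open>The inequalities between the \<open>k\<close> and \<open>m\<close> place
  \<open>\<rho> p\<close> in the range required by \<open>tangents_bound\<close>. The condition
  \<open>2 * e < p\<close> makes \<open>(p - 1) / 2 - e\<close> nonnegative, so that it can be the
  second digit.\<close>

definition certificate :: "int \<Rightarrow> int \<Rightarrow> int \<Rightarrow> nat \<Rightarrow> nat \<Rightarrow> nat \<Rightarrow> nat \<Rightarrow> bool" where
  "certificate p x e k1 m1 k2 m2 \<longleftrightarrow>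
     (x = 1 \<and> 29 * k2 \<le> 23 * m2 \<or> x = 2 \<and> 76 * k2 \<le> 65 * m2 \<and> 4 * m1 \<le> 5 * k1) \<and>
     0 \<le> e \<and> 2 * e < p \<and> rho_bounds_ok p k1 m1 k2 m2 \<and>
     digits_ok p x ((2 * x + 1) * p - 2 * e) ((x + 1) * (2 * p * (p + 1) * x + (p - 2 * e) * (p - 2 * e + 1)))
       [(int k1, int m1), (int k2, int m2)]"

lemma B_eq:
  fixes x e :: int
  assumes "0 < x" "0 < p"
  shows "B p x e = (real_of_int x + 1) * (x / 2 + (real p - 2 * real_of_int e) * (real p - 2 * real_of_int e + 1) / (4 * (real p * (real p + 1)))) *
    (((2 * x + 1) * int p - 2 * e) / (2 * real p)) powr (- \<rho> p)"
proof -
  have choose: "(real_of_int x + 1) gchoose 2 = (real_of_int x + 1) * x / 2"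
    by (simp add: gbinomial_prod_rev numeral_2_eq_2)
  have scale: "(X + 1) * X / 2 * (1 + D / (2 * X * Q)) = (X + 1) * (X / 2 + D / (4 * Q))"
    if "0 < X" "0 < Q" for X Q D :: real
    using that by (simp add: field_simps)
  have denom: "2 * real_of_int x * real p * (real p + 1) = 2 * real_of_int x * (real p * (real p + 1))"
    by simp
  have "((real_of_int x + 1) gchoose 2) *
      (1 + (real p - 2 * real_of_int e) * (real p - 2 * real_of_int e + 1) / (2 * real_of_int x * real p * (real p + 1))) =
    (real_of_int x + 1) * (x / 2 + (real p - 2 * real_of_int e) * (real p - 2 * real_of_int e + 1) / (4 * (real p * (real p + 1))))"
    unfolding choose denom using assms by (intro scale) auto
  moreover have "(2 * real_of_int x + 1) / 2 - e / real p = ((2 * x + 1) * int p - 2 * e) / (2 * real p)"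
    using assms by (simp add: field_simps)
  ultimately show ?thesis
    by (simp add: B_def)
qed

lemma \<beta>_eq_B:
  assumes p: "prime p" "odd p" and cert: "certificate (int p) x e k1 m1 k2 m2"
  shows "\<beta> p = B p x e"
proof (rule antisym)
  define Y where "Y = (2 * x + 1) * int p - 2 * e"
  define c where "c = (x + 1) * (2 * int p * (int p + 1) * x + (int p - 2 * e) * (int p - 2 * e + 1))"
  define C where "C = c / (4 * (real p * (real p + 1)))"
  have p3: "p \<ge> 3"
    using p prime_ge_2_nat[of p] by (cases "p = 2") auto
  have x: "x = 1 \<or> x = 2" and e: "0 \<le> e" "2 * e < int p"
    and x_bounds: "x = 1 \<and> 29 * k2 \<le> 23 * m2 \<or> x = 2 \<and> 76 * k2 \<le> 65 * m2 \<and> 4 * m1 \<le> 5 * k1"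
    and bounds_ok: "rho_bounds_ok (int p) k1 m1 k2 m2"
    and digits: "digits_ok (int p) x Y c [(int k1, int m1), (int k2, int m2)]"
    using cert by (auto simp: certificate_def Y_def c_def)
  have m: "0 < m1" "0 < m2" "k2 \<le> m2"
    using bounds_ok by (auto simp: rho_bounds_ok_def)
  have Y: "0 < Y"
  proof -
    have "0 \<le> 2 * x * int p"
      using x by auto
    then show ?thesis
      using e by (simp add: Y_def algebra_simps)
  qed
  have "0 \<le> c"
    unfolding c_def using x e by (intro mult_nonneg_nonneg add_nonneg_nonneg) auto
  then have C: "0 \<le> C"
    by (simp add: C_def)
  have B: "B p x e = C * (Y / (2 * real p)) powr (- \<rho> p)"
  proof -
    have "(X + 1) * (X / 2 + D / (4 * Q)) = (X + 1) * (2 * Q * X + D) / (4 * Q)" if "0 < Q" for X Q D :: real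
      using that by (simp add: field_simps)
    moreover have "real_of_int c = (real_of_int x + 1) *
        (2 * (real p * (real p + 1)) * x + (real p - 2 * real_of_int e) * (real p - 2 * real_of_int e + 1))"
      by (simp add: c_def mult.assoc)
    ultimately have "(real_of_int x + 1) * (x / 2 + (real p - 2 * real_of_int e) * (real p - 2 * real_of_int e + 1) / (4 * (real p * (real p + 1)))) = C"
      using p3 by (simp add: C_def)
    then show ?thesis
      using B_eq[of x p e] x p3 by (auto simp: Y_def)
  qed
  note rho = rho_bounds[OF p bounds_ok]
  have rho_x: "x = 1 \<and> \<rho> p \<le> 52 / 29 \<or> x = 2 \<and> 9 / 5 \<le> \<rho> p \<and> \<rho> p \<le> 141 / 76"
  proof -
    have upper: "\<rho> p \<le> 1 + r / s" if "s * k2 \<le> r * m2" "0 < s" for r s :: nat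
      using that m by (intro order_trans[OF rho(2)]) (simp add: field_simps flip: of_nat_mult)
    have lower: "1 + r / s \<le> \<rho> p" if "r * m1 \<le> s * k1" "0 < s" for r s :: nat
      using that m by (intro order_trans[OF _ rho(1)]) (simp add: field_simps flip: of_nat_mult)
    show ?thesis
      using x_bounds upper[of 29 23] upper[of 76 65] lower[of 4 5] by auto
  qed
  have ok: "first_digit_ok (int p) Y c r (large_tangent x) b"
      "w \<in> set (small_tangents x) \<Longrightarrow> second_digit_ok (int p) Y c r w b"
    if "r \<in> {(int k1, int m1), (int k2, int m2)}" "b \<in> set (int_breakpoints (int p))" for r b w
    using digits that by (auto simp: digits_ok_def list_all_iff)
  have r_cases: "\<exists>k m. (k, m) \<in> {(int k1, int m1), (int k2, int m2)} \<and> 0 < m \<and> r = 1 + k / m"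
    if "r \<in> {1 + k1 / m1, 1 + k2 / m2}" for r
    using that m by force
  have bp: "\<exists>S T V. (S, T, V) \<in> set (int_breakpoints (int p)) \<and> S > 0 \<and> t = T / S \<and> v = V / S"
    if "(t, v) \<in> breakpoints (real p)" for t v
    using breakpoints_eq_int_breakpoints[of "int p" t v] that p3 by simp
  show "B p x e \<le> \<beta> p"
    unfolding B \<beta>_def
  proof (rule cINF_greatest)
    fix n :: nat
    assume "n \<in> {1..}"
    show "C * (Y / (2 * real p)) powr (- \<rho> p) \<le> real (F p n) / real n powr \<rho> p"
    proof (rule F_lower_bound[OF p _ C _ rho(1) rho(2)])
      show "\<exists>\<kappa> w. 0 < w \<and> (w / (Y / (2 * real p))) powr \<rho> p \<le> \<kappa> \<and>
          (\<forall>b::nat. \<forall>(t, v)\<in>breakpoints (real p). \<forall>r\<in>{1 + k1 / m1, 1 + k2 / m2}.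
            \<kappa> * C * quad_fun r ((real a * real p + real b + t) / (real p * w)) \<le>
            (real a + 1) * (real a / 2 + (real b + 1) * (real b / 2 + v) / (real p * (real p + 1) / 2)))"
        if "a \<in> {1..4}" for a :: nat
      proof -
        have "a \<in> {1, 2, 3, 4}"
          using that by auto
        then have "int a \<in> fst ` set (small_tangents x)"
          by (auto simp: small_tangents_def)
        then obtain u v K M where tangent: "(int a, u, v, K, M) \<in> set (small_tangents x)"
          by force
        then have uv: "0 < u" "0 < v" "0 < M" "(u / v) powr \<rho> p \<le> K / M"
          using tangents_bound[OF rho_x] by blast+
        show ?thesis
        \<comment> \<open>The touching point is \<open>u / v\<close> times the limit point
          \<open>Y / (2 * p)\<close>, so the ratio of powers is that of
          \<open>u / v\<close>.\<close>
        proof (rule exI[of _ "K / M"], rule exI[of _ "Y / (2 * real p) * (u / v)"], intro conjI allI ballI)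
          show "0 < Y / (2 * real p) * (u / v)"
            using Y uv p3 by simp
          show "(Y / (2 * real p) * (u / v) / (Y / (2 * real p))) powr \<rho> p \<le> K / M"
            using Y uv p3 by simp
          fix b :: nat and tv
          assume tv: "tv \<in> breakpoints (real p)"
          obtain t w where tw: "tv = (t, w)"
            by fastforce
          obtain S T V where STV: "(S, T, V) \<in> set (int_breakpoints (int p))" "S > 0" "t = T / S" "w = V / S"
            using bp tv tw by blast
          show "case tv of (t, v') \<Rightarrow> \<forall>r\<in>{1 + k1 / m1, 1 + k2 / m2}.
              K / M * C * quad_fun r ((real a * real p + real b + t) /
                (real p * (Y / (2 * real p) * (u / v)))) \<le>
              (real a + 1) * (real a / 2 + (real b + 1) * (real b / 2 + v') / (real p * (real p + 1) / 2))"
            unfolding tw prod.case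
          proof
            fix r
            assume "r \<in> {1 + real k1 / real m1, 1 + real k2 / real m2}"
            then obtain k m where km: "(k, m) \<in> {(int k1, int m1), (int k2, int m2)}" "0 < m" "r = 1 + k / m"
              using r_cases by blast
            show "K / M * C * quad_fun r ((real a * real p + real b + t) /
                (real p * (Y / (2 * real p) * (u / v)))) \<le>
              (real a + 1) * (real a / 2 + (real b + 1) * (real b / 2 + w) / (real p * (real p + 1) / 2))"
              unfolding km(3) C_def
              using p3 by (intro second_digit_ok_imp[OF ok(2)[OF km(1) STV(1) tangent] _ Y km(2) STV(2) uv(1-3) STV(3,4)]) simp
          qed
        qed
      qed
      show "\<exists>\<kappa> w. 0 < w \<and> (w / (Y / (2 * real p))) powr \<rho> p \<le> \<kappa> \<and>
          (\<forall>a::nat. 5 \<le> a \<longrightarrow> (\<forall>(t, v)\<in>breakpoints (real p). \<forall>r\<in>{1 + k1 / m1, 1 + k2 / m2}.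
            \<kappa> * C * quad_fun r ((real a + t) / w) \<le> (real a + 1) * (real a / 2 + v)))"
      proof -
        obtain u v K M where tangent: "large_tangent x = (u, v, K, M)"
          using prod_cases4 by blast
        then have uv: "0 < u" "0 < v" "0 < M" "(u / v) powr \<rho> p \<le> K / M"
          using tangents_bound[OF rho_x, of _ u v K M] by auto
        show ?thesis
        proof (rule exI[of _ "K / M"], rule exI[of _ "Y / (2 * real p) * (u / v)"], intro conjI allI ballI impI)
          show "0 < Y / (2 * real p) * (u / v)"
            using Y uv p3 by simp
          show "(Y / (2 * real p) * (u / v) / (Y / (2 * real p))) powr \<rho> p \<le> K / M"
            using Y uv p3 by simp
          fix a :: nat and tv
          assume a: "5 \<le> a" and tv: "tv \<in> breakpoints (real p)"
          obtain t w where tw: "tv = (t, w)"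
            by fastforce
          obtain S T V where STV: "(S, T, V) \<in> set (int_breakpoints (int p))" "S > 0" "t = T / S" "w = V / S"
            using bp tv tw by blast
          show "case tv of (t, v') \<Rightarrow> \<forall>r\<in>{1 + k1 / m1, 1 + k2 / m2}.
              K / M * C * quad_fun r ((real a + t) / (Y / (2 * real p) * (u / v))) \<le>
              (real a + 1) * (real a / 2 + v')"
            unfolding tw prod.case
          proof
            fix r
            assume "r \<in> {1 + real k1 / real m1, 1 + real k2 / real m2}"
            then obtain k m where km: "(k, m) \<in> {(int k1, int m1), (int k2, int m2)}" "0 < m" "r = 1 + k / m"
              using r_cases by blast
            show "K / M * C * quad_fun r ((real a + t) / (Y / (2 * real p) * (u / v))) \<le>
              (real a + 1) * (real a / 2 + w)"
              unfolding km(3) C_def using p3 ok(1)[OF km(1) STV(1)] unfolding tangent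
              by (intro first_digit_ok_imp[OF _ a _ Y km(2) STV(2) uv(1-3) STV(3,4)]) auto
          qed
        qed
      qed
    qed (use Y p3 m \<open>n \<in> {1..}\<close> in auto)
  qed simp
  show "\<beta> p \<le> B p x e"
  proof -
    obtain j where j: "p = 2 * j + 1"
      using p by (elim oddE)
    \<comment> \<open>The second digit \<open>(p - 1) / 2 - e\<close> of the numbers approaching the
      infimum.\<close>
    define d where "d = nat (int j - e)"
    have d: "real d = real j - e"
      using e j by (simp add: d_def)
    have d2: "2 * real d + 1 = real p - 2 * real_of_int e"
      by (simp add: d j)
    have "\<beta> p \<le> (real (nat x) + 1) * (real (nat x) / 2 + (real d + 1) * (2 * real d + 1) / (2 * real p * (real p + 1))) *
        (real (nat x) + (2 * real d + 1) / (2 * real p)) powr (- \<rho> p)"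
      using p p3 x e j by (intro \<beta>_upper_bound) (auto simp: d_def)
    also have "\<dots> = B p x e"
    proof -
      have "real (nat x) = x"
        using x by auto
      moreover have "(real d + 1) * (2 * real d + 1) / (2 * real p * (real p + 1)) =
          (real p - 2 * real_of_int e) * (real p - 2 * real_of_int e + 1) / (4 * (real p * (real p + 1)))"
      proof -
        have d1: "real d + 1 = (real p - 2 * real_of_int e + 1) / 2"
          using d2 by simp
        show ?thesis
          unfolding d2 unfolding d1 by simp
      qed
      moreover have "x + (2 * real d + 1) / (2 * real p) = ((2 * x + 1) * int p - 2 * e) / (2 * real p)"
        unfolding d2 using p3 by (simp add: field_simps)
      ultimately show ?thesis
        using B_eq[of x p e] x p3 by auto
    qed
    finally show ?thesis .
  qed
qed

text \<open>In this and the following lemmas the four numerals give fractions \<open>k1 / m1\<close>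
  and \<open>k2 / m2\<close> enclosing \<open>\<rho> p - 1\<close>. The certificate is then
  evaluated in integer arithmetic.\<close>

lemma \<beta>_3: "\<beta> 3 = B 3 1 0"
  by (rule \<beta>_eq_B[of _ _ _ 1 2 2 3]) (simp, simp, code_simp)

lemma \<beta>_5: "\<beta> 5 = B 5 1 0"
  by (rule \<beta>_eq_B[of _ _ _ 2 3 3 4]) (simp, simp, code_simp)

lemma \<beta>_7: "\<beta> 7 = B 7 1 0"
  by (rule \<beta>_eq_B[of _ _ _ 7 10 3 4]) (simp, simp, code_simp)

lemma \<beta>_11: "\<beta> 11 = B 11 1 1"
  by (rule \<beta>_eq_B[of _ _ _ 2 3 3 4]) (simp, simp, code_simp)

lemma \<beta>_13: "\<beta> 13 = B 13 1 1"
  by (rule \<beta>_eq_B[of _ _ _ 2 3 7 9]) (simp, simp, code_simp)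

lemma \<beta>_17: "\<beta> 17 = B 17 1 1"
  by (rule \<beta>_eq_B[of _ _ _ 3 4 7 9]) (simp, simp, code_simp)

lemma \<beta>_19: "\<beta> 19 = B 19 1 1"
  by (rule \<beta>_eq_B[of _ _ _ 3 4 11 14]) (simp, simp, code_simp)

lemma \<beta>_23: "\<beta> 23 = B 23 1 1"
  by (rule \<beta>_eq_B[of _ _ _ 7 9 23 29]) (simp, simp, code_simp)

lemma \<beta>_29: "\<beta> 29 = B 29 2 1"
  by (rule \<beta>_eq_B[of _ _ _ 41 51 5 6]) (simp, simp, code_simp)

lemma \<beta>_31: "\<beta> 31 = B 31 2 2"
  by (rule \<beta>_eq_B[of _ _ _ 4 5 17 21]) (simp, simp, code_simp)

lemma \<beta>_37: "\<beta> 37 = B 37 2 2"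
  by (rule \<beta>_eq_B[of _ _ _ 4 5 5 6]) (simp, simp, code_simp)

lemma \<beta>_41: "\<beta> 41 = B 41 2 2"
  by (rule \<beta>_eq_B[of _ _ _ 4 5 5 6]) (simp, simp, code_simp)

lemma \<beta>_43: "\<beta> 43 = B 43 2 2"
  by (rule \<beta>_eq_B[of _ _ _ 4 5 5 6]) (simp, simp, code_simp)

lemma \<beta>_47: "\<beta> 47 = B 47 2 2"
  by (rule \<beta>_eq_B[of _ _ _ 9 11 5 6]) (simp, simp, code_simp)

lemma \<beta>_53: "\<beta> 53 = B 53 2 2"
  by (rule \<beta>_eq_B[of _ _ _ 29 35 5 6]) (simp, simp, code_simp)

lemma \<beta>_59: "\<beta> 59 = B 59 2 3"
  by (rule \<beta>_eq_B[of _ _ _ 4 5 16 19]) (simp, simp, code_simp)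

lemma \<beta>_61: "\<beta> 61 = B 61 2 3"
  by (rule \<beta>_eq_B[of _ _ _ 4 5 11 13]) (simp, simp, code_simp)

lemma \<beta>_67: "\<beta> 67 = B 67 2 3"
  by (rule \<beta>_eq_B[of _ _ _ 5 6 11 13]) (simp, simp, code_simp)

lemma \<beta>_71: "\<beta> 71 = B 71 2 3"
  by (rule \<beta>_eq_B[of _ _ _ 5 6 11 13]) (simp, simp, code_simp)

lemma \<beta>_73: "\<beta> 73 = B 73 2 3"
  by (rule \<beta>_eq_B[of _ _ _ 5 6 11 13]) (simp, simp, code_simp)

lemma \<beta>_79: "\<beta> 79 = B 79 2 3"
  by (rule \<beta>_eq_B[of _ _ _ 27 32 11 13]) (simp, simp, code_simp)

lemma \<beta>_83: "\<beta> 83 = B 83 2 4"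
  by (rule \<beta>_eq_B[of _ _ _ 5 6 11 13]) (simp, simp, code_simp)

lemma \<beta>_89: "\<beta> 89 = B 89 2 4"
  by (rule \<beta>_eq_B[of _ _ _ 5 6 17 20]) (simp, simp, code_simp)

lemma \<beta>_97: "\<beta> 97 = B 97 2 4"
  by (rule \<beta>_eq_B[of _ _ _ 11 13 23 27]) (simp, simp, code_simp)

lemma \<beta>_101: "\<beta> 101 = B 101 2 4"
  by (rule \<beta>_eq_B[of _ _ _ 11 13 29 34]) (simp, simp, code_simp)

lemma \<beta>_103: "\<beta> 103 = B 103 2 4"
  by (rule \<beta>_eq_B[of _ _ _ 17 20 29 34]) (simp, simp, code_simp)

lemma \<beta>_107: "\<beta> 107 = B 107 2 4"
  by (rule \<beta>_eq_B[of _ _ _ 64 75 35 41]) (simp, simp, code_simp)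

lemma \<beta>_109: "\<beta> 109 = B 109 2 5"
  by (rule \<beta>_eq_B[of _ _ _ 5 6 47 55]) (simp, simp, code_simp)

lemma \<beta>_113: "\<beta> 113 = B 113 2 5"
  by (rule \<beta>_eq_B[of _ _ _ 5 6 65 76]) (simp, simp, code_simp)

lemma odd_primes_upto_113:
  fixes p :: nat
  assumes "prime p" "odd p" "p \<le> 113"
  shows "p \<in> {3, 5, 7, 11, 13, 17, 19, 23, 29, 31, 37, 41, 43, 47, 53, 59, 61, 67, 71, 73, 79, 83, 89, 97, 101, 103, 107, 109, 113}"
proof -
  have dvd: "\<not> d dvd p \<or> p = d" if "d \<in> {3, 5, 7}" for d
    using that assms(1) by (auto simp: prime_nat_iff)
  \<comment> \<open>Since 11 squared exceeds 113, sieving by 3, 5 and 7 leaves exactly the odd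
    primes.\<close>
  have sieve: "\<forall>n\<in>{..113::nat}. odd n \<and> n \<noteq> 1 \<and> (\<forall>d\<in>{3, 5, 7}. \<not> d dvd n \<or> n = d) \<longrightarrow>
      n \<in> {3, 5, 7, 11, 13, 17, 19, 23, 29, 31, 37, 41, 43, 47, 53, 59, 61, 67, 71, 73, 79, 83, 89, 97, 101, 103, 107, 109, 113}"
    by code_simp
  have "p \<noteq> 1"
    using assms(1) by auto
  then show ?thesis
    using sieve dvd assms(2,3) by auto
qed

theorem theorem1p1:
  shows "\<beta> 5 = (3 / 2) powr (1 - \<rho> 5)
    \<and> \<beta> 7 = (3 / 2) powr (1 - \<rho> 7)
    \<and> \<beta> 11 = 59 / 44 * (22 / 31) powr (\<rho> 11)
    \<and> (\<forall>p. prime p \<and> odd p \<and> 3 \<le> p \<and> p \<le> 113 \<longrightarrow>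
          (case \<xi>\<eta> p of (\<xi>, \<eta>) \<Rightarrow> \<beta> p = B p \<xi> \<eta>))"
proof (intro conjI allI impI)
  \<comment> \<open>For \<open>(1, 0)\<close> both the prefactor and the base of the power in
    \<open>B\<close> equal \<open>3 / 2\<close>.\<close>
  show "\<beta> 5 = (3 / 2) powr (1 - \<rho> 5)" "\<beta> 7 = (3 / 2) powr (1 - \<rho> 7)"
    by (simp_all add: \<beta>_5 \<beta>_7 B_eq powr_diff powr_minus_divide)
  \<comment> \<open>For \<open>p = 11\<close> and \<open>(1, 1)\<close> the base is
    \<open>3 / 2 - 1 / 11 = 31 / 22\<close> and the prefactor
    \<open>1 + 90 / 264 = 59 / 44\<close>.\<close>
  have "(31 / 22) powr (- \<rho> 11) = (22 / 31) powr \<rho> 11"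
    by (simp add: powr_minus_divide powr_divide)
  then show "\<beta> 11 = 59 / 44 * (22 / 31) powr (\<rho> 11)"
    by (simp add: \<beta>_11 B_eq)
next
  fix p :: nat
  assume "prime p \<and> odd p \<and> 3 \<le> p \<and> p \<le> 113"
  then have "p \<in> {3, 5, 7, 11, 13, 17, 19, 23, 29, 31, 37, 41, 43, 47, 53, 59, 61, 67, 71, 73, 79, 83, 89, 97, 101, 103, 107, 109, 113}"
    by (intro odd_primes_upto_113) auto
  then show "case \<xi>\<eta> p of (\<xi>, \<eta>) \<Rightarrow> \<beta> p = B p \<xi> \<eta>"
    by (elim insertE emptyE) (simp_all add: \<xi>\<eta>_def \<beta>_3 \<beta>_5 \<beta>_7 \<beta>_11 \<beta>_13 \<beta>_17 \<beta>_19 \<beta>_23 \<beta>_29 \<beta>_31 \<beta>_37 \<beta>_41 \<beta>_43 \<beta>_47 \<beta>_53 \<beta>_59 \<beta>_61 \<beta>_67 \<beta>_71 \<beta>_73 \<beta>_79 \<beta>_83 \<beta>_89 \<beta>_97 \<beta>_101 \<beta>_103 \<beta>_107 \<beta>_109 \<beta>_113)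
qed

end
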